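(* Let $h_1,\dots,h_K:\mathbb{R}\to\mathbb{R}$ be measurable functions and let $s_k(\mu)=\mathbb{E}_{Z\sim\mu}[h_k(Z)]$, $k=1,\dots,K$. If the set of statistics $\{s_1,\dots,s_K\}$ is Bellman closed, then there exists $L\le K$ such that the linear span of the functionals $\{s_0,s_1,\dots,s_K\}$ equals the linear span of the moment functionals $\{\mu\mapsto \mathbb{E}_{Z\sim\mu}[Z^l] : l=0,1,\dots,L\}$, where $s_0$ denotes the constant functional $s_0(\mu)=1$.
   Context: MDP setting: a Markov decision process has finite state space $\mathcal X$, finite action space $\mathcal A$, transition kernel $p(\cdot\mid x,a)$, discount factor $\gamma\in[0,1)$, and reward distributions $\mathcal R(\cdot\mid x,a)$ on $\mathbb{R}$. A (Markov) policy is a map $\pi:\mathcal X\to\mathscr P(\mathcal A)$. Given $X_0=x,A_0=a$, the trajectory is generated by $R_t\sim\mathcal R(\cdot\mid X_t,A_t)$, $X_{t+1}\sim p(\cdot\mid X_t,A_t)$, $A_{t+1}\sim\pi(\cdot\mid X_{t+1})$, and the return distribution $\eta^\pi(x,a)$ is the law of $\sum_{t\ge0}\gamma^tR_t$. A statistic is a map $s$ from (a subset of) the set of probability distributions on $\mathbb{R}$ to $\mathbb{R}$; statistics of the form $\mathbb{E}[h(Z)]$ are defined on those distributions for which the expectation is finite, and only MDPs whose return distributions lie in this domain are considered. Bellman closedness: a finite set of statistics $\{s_1,\dots,s_K\}$ is Bellman closed if the values $s_{1:K}(\eta^\pi(x,a))$ can be expressed in an MDP-independent manner in terms of $\gamma$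 and the joint law of the random variables $R_0$ and $s_{1:K}(\eta^\pi(X_1,A_1))$ conditional on $X_0=x,A_0=a$; i.e. for each $\gamma\in[0,1)$ there is a single map $G_\gamma$ such that for every MDP with discount $\gamma$, every policy $\pi$ and every $(x,a)\in\mathcal X\times\mathcal A$, $s_{1:K}(\eta^\pi(x,a))=G_\gamma\big(\mathrm{Law}(R_0, s_{1:K}(\eta^\pi(X_1,A_1))\mid X_0=x,A_0=a)\big)$. *)

theory Defs
  imports "HOL-Probability.Probability" "HOL-Library.Function_Algebras"
begin

text \<open>States are {..<nX}, actions are {..<nA} (any finite state/action spaces up to renaming).
  p x a : transition kernel, R x a : reward distribution, pol x : policy.\<close>

type_synonym step = "((nat \<times> nat \<Rightarrow> real) \<times> (nat \<times> nat \<Rightarrow> nat) \<times> (nat \<Rightarrow> nat))"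

definition wf_mdp ::
  "nat \<Rightarrow> nat \<Rightarrow> (nat \<Rightarrow> nat \<Rightarrow> nat pmf) \<Rightarrow> (nat \<Rightarrow> nat \<Rightarrow> real measure) \<Rightarrow> (nat \<Rightarrow> nat pmf) \<Rightarrow> bool" where
  "wf_mdp nX nA p R pol \<longleftrightarrow> 0 < nX \<and> 0 < nA \<and>
     (\<forall>x<nX. \<forall>a<nA. set_pmf (p x a) \<subseteq> {..<nX} \<and> prob_space (R x a) \<and> sets (R x a) = sets borel) \<and>
     (\<forall>x<nX. set_pmf (pol x) \<subseteq> {..<nA})"

definition step_space ::
  "nat \<Rightarrow> nat \<Rightarrow> (nat \<Rightarrow> nat \<Rightarrow> nat pmf) \<Rightarrow> (nat \<Rightarrow> nat \<Rightarrow> real measure) \<Rightarrow> (nat \<Rightarrow> nat pmf) \<Rightarrow> step measure" where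
  "step_space nX nA p R pol =
     (\<Pi>\<^sub>M xa\<in>{..<nX} \<times> {..<nA}. R (fst xa) (snd xa)) \<Otimes>\<^sub>M
     ((\<Pi>\<^sub>M xa\<in>{..<nX} \<times> {..<nA}. measure_pmf (p (fst xa) (snd xa))) \<Otimes>\<^sub>M
      (\<Pi>\<^sub>M x\<in>{..<nX}. measure_pmf (pol x)))"

definition traj_space ::
  "nat \<Rightarrow> nat \<Rightarrow> (nat \<Rightarrow> nat \<Rightarrow> nat pmf) \<Rightarrow> (nat \<Rightarrow> nat \<Rightarrow> real measure) \<Rightarrow> (nat \<Rightarrow> nat pmf) \<Rightarrow> (nat \<Rightarrow> step) measure" where
  "traj_space nX nA p R pol = (\<Pi>\<^sub>M t\<in>(UNIV::nat set). step_space nX nA p R pol)"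

primrec sa :: "(nat \<Rightarrow> step) \<Rightarrow> nat \<Rightarrow> nat \<Rightarrow> nat \<Rightarrow> nat \<times> nat" where
  "sa \<omega> x a 0 = (x, a)"
| "sa \<omega> x a (Suc t) =
     (let x' = fst (snd (\<omega> t)) (sa \<omega> x a t) in (x', snd (snd (\<omega> t)) x'))"

definition rew :: "(nat \<Rightarrow> step) \<Rightarrow> nat \<Rightarrow> nat \<Rightarrow> nat \<Rightarrow> real" where
  "rew \<omega> x a t = fst (\<omega> t) (sa \<omega> x a t)"

definition ret_dist ::
  "nat \<Rightarrow> nat \<Rightarrow> (nat \<Rightarrow> nat \<Rightarrow> nat pmf) \<Rightarrow> (nat \<Rightarrow> nat \<Rightarrow> real measure) \<Rightarrow> (nat \<Rightarrow> nat pmf) \<Rightarrow> real \<Rightarrow> nat \<Rightarrow> nat \<Rightarrow> real measure" where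
  "ret_dist nX nA p R pol \<gamma> x a =
     distr (traj_space nX nA p R pol) borel (\<lambda>\<omega>. \<Sum>t. \<gamma> ^ t * rew \<omega> x a t)"

definition stat :: "(nat \<Rightarrow> real \<Rightarrow> real) \<Rightarrow> nat \<Rightarrow> real measure \<Rightarrow> nat \<Rightarrow> real" where
  "stat h K \<mu> = (\<lambda>k. if k \<in> {1..K} then (\<integral>z. h k z \<partial>\<mu>) else 0)"

definition stat_dom :: "(nat \<Rightarrow> real \<Rightarrow> real) \<Rightarrow> nat \<Rightarrow> real measure set" where
  "stat_dom h K = {\<mu>. prob_space \<mu> \<and> sets \<mu> = sets borel \<and> (\<forall>k\<in>{1..K}. integrable \<mu> (h k))}"

text \<open>MDPs that are considered: well-formed, the discounted reward series converges almost
  surely (so the return is defined), and all return distributions lie in the domain.\<close>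
definition admissible_mdp ::
  "(nat \<Rightarrow> real \<Rightarrow> real) \<Rightarrow> nat \<Rightarrow> real \<Rightarrow> nat \<Rightarrow> nat \<Rightarrow> (nat \<Rightarrow> nat \<Rightarrow> nat pmf) \<Rightarrow> (nat \<Rightarrow> nat \<Rightarrow> real measure) \<Rightarrow> (nat \<Rightarrow> nat pmf) \<Rightarrow> bool" where
  "admissible_mdp h K \<gamma> nX nA p R pol \<longleftrightarrow> wf_mdp nX nA p R pol \<and>
     (\<forall>x<nX. \<forall>a<nA.
        (AE \<omega> in traj_space nX nA p R pol. summable (\<lambda>t. \<gamma> ^ t * rew \<omega> x a t)) \<and>
        ret_dist nX nA p R pol \<gamma> x a \<in> stat_dom h K)"

definition next_law ::
  "(nat \<Rightarrow> real \<Rightarrow> real) \<Rightarrow> nat \<Rightarrow> real \<Rightarrow> nat \<Rightarrow> nat \<Rightarrow> (nat \<Rightarrow> nat \<Rightarrow> nat pmf) \<Rightarrow> (nat \<Rightarrow> nat \<Rightarrow> real measure) \<Rightarrow> (nat \<Rightarrow> nat pmf) \<Rightarrow> nat \<Rightarrow> nat \<Rightarrow> (real \<times> (nat \<Rightarrow> real)) measure" where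
  "next_law h K \<gamma> nX nA p R pol x a =
     distr (traj_space nX nA p R pol) borel
       (\<lambda>\<omega>. (rew \<omega> x a 0,
              stat h K (ret_dist nX nA p R pol \<gamma> (fst (sa \<omega> x a 1)) (snd (sa \<omega> x a 1)))))"

definition bellman_closed :: "(nat \<Rightarrow> real \<Rightarrow> real) \<Rightarrow> nat \<Rightarrow> bool" where
  "bellman_closed h K \<longleftrightarrow>
     (\<forall>\<gamma>. 0 \<le> \<gamma> \<and> \<gamma> < 1 \<longrightarrow>
       (\<exists>G :: (real \<times> (nat \<Rightarrow> real)) measure \<Rightarrow> (nat \<Rightarrow> real).
          \<forall>nX nA p R pol. admissible_mdp h K \<gamma> nX nA p R pol \<longrightarrow>
            (\<forall>x<nX. \<forall>a<nA. stat h K (ret_dist nX nA p R pol \<gamma> x a) = G (next_law h K \<gamma> nX nA p R pol x a))))"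

definition on_dom :: "real measure set \<Rightarrow> (real measure \<Rightarrow> real) \<Rightarrow> real measure \<Rightarrow> real" where
  "on_dom D f = (\<lambda>\<mu>. if \<mu> \<in> D then f \<mu> else 0)"

definition fspan :: "(real measure \<Rightarrow> real) set \<Rightarrow> (real measure \<Rightarrow> real) set" where
  "fspan S = module.span (\<lambda>c f. (\<lambda>\<mu>. c * f \<mu>)) S"

definition moment :: "nat \<Rightarrow> real measure \<Rightarrow> real" where
  "moment l \<mu> = (\<integral>z. z ^ l \<partial>\<mu>)"

end

theory Submission
  imports Defs
begin

text \<open>
  Let \<open>V\<close> be the span of \<open>1, h\<^sub>1, \<dots>, h\<^sub>K\<close> as functions on the reals. In a chain of three states one
  sees that two finitely supported laws with equal statistics still have equal statistics after
  \<open>z \<mapsto> r + \<gamma> z\<close>. By duality \<open>V\<close> is invariant under these maps, and, having finite dimension, also under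
  their inverses, hence under translations and contractions. An invariant finite-dimensional space of
  measurable functions consists of continuous functions (Lusin and Steinhaus), hence of smooth ones
  (averaging). If \<open>x ^ n\<close> is the first monomial outside \<open>V\<close>, rescaling Taylor expansions at \<open>0\<close>
  shows that the \<open>n\<close>-th derivative of every member of \<open>V\<close> vanishes at \<open>0\<close>, and by translation
  everywhere; so \<open>V\<close> is spanned by the monomials of degree less than \<open>n\<close>.

  The recurrent technical device is interpolation: a finite-dimensional function space \<open>W\<close> has finitely
  many points \<open>z\<close> and members \<open>e z\<close> with \<open>f = (\<Sum>z. f z * e z)\<close> for all \<open>f\<close> in \<open>W\<close>.
\<close>

section \<open>Finite-dimensional spaces of functions\<close>

interpretation fs: vector_space "\<lambda>(c::real) (f::'a \<Rightarrow> real) x. c * f x"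
  by unfold_locales (auto simp: fun_eq_iff algebra_simps)

text \<open>As rewrite rules these match arbitrary abstractions and undo \<open>algebra_simps\<close>.\<close>
declare fs.scale_scale [simp del] fs.scale_one [simp del] fs.scale_zero_left [simp del]
  fs.scale_minus_left [simp del] fs.scale_zero_right [simp del] fs.scale_minus_right [simp del]
  fs.scale_eq_0_iff [simp del] fs.scale_cancel_left [simp del] fs.scale_cancel_right [simp del]

lemma sum_fun_eval: "(\<Sum>i\<in>A. F i) x = (\<Sum>i\<in>A. F i x)"
  for F :: "'i \<Rightarrow> 'a \<Rightarrow> real"
  by (induction A rule: infinite_finite_induct) auto

lemma fs_subspace_lincomb:
  assumes "fs.subspace W" "\<And>i. i \<in> A \<Longrightarrow> e i \<in> W"
  shows "(\<lambda>x. \<Sum>i\<in>A. c i * e i x) \<in> W"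
proof -
  have "(\<Sum>i\<in>A. (\<lambda>x. c i * e i x)) \<in> W"
    by (intro fs.subspace_sum fs.subspace_scale assms)
  also have "(\<Sum>i\<in>A. (\<lambda>x. c i * e i x)) = (\<lambda>x. \<Sum>i\<in>A. c i * e i x)"
    by (rule ext) (simp add: sum_fun_eval)
  finally show ?thesis .
qed

lemma fs_subspace_diff:
  assumes "fs.subspace W" "f \<in> W" "g \<in> W"
  shows "(\<lambda>x. f x - g x) \<in> W"
  using fs.subspace_diff[OF assms] by (simp add: fun_diff_def)

text \<open>Adding a generator either leaves the span unchanged or leaves a nonzero remainder after
  interpolation at the old nodes; a point where the remainder does not vanish becomes the new
  node.\<close>

lemma span_interpolation:
  fixes B :: "('a \<Rightarrow> real) set"
  assumes "finite B"
  shows "\<exists>Z e. finite Z \<and> (\<forall>z\<in>Z. e z \<in> fs.span B) \<and>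
           (\<forall>f\<in>fs.span B. \<forall>x. f x = (\<Sum>z\<in>Z. f z * e z x))"
proof -
  \<comment> \<open>Duality of the \<open>e z\<close> to the nodes is carried through the induction:
    it makes the remainder of the next generator vanish at all old nodes.\<close>
  have "\<exists>Z e. finite Z \<and> (\<forall>z\<in>Z. e z \<in> fs.span B) \<and>
           (\<forall>z\<in>Z. \<forall>y\<in>Z. e z y = (if z = y then 1 else 0)) \<and>
           (\<forall>f\<in>fs.span B. \<forall>x. f x = (\<Sum>z\<in>Z. f z * e z x))"
    using assms
  proof (induction B)
    case empty
    show ?case by (rule exI[of _ "{}"]) auto
  next
    case (insert b B)
    from insert.IH obtain Z e where IH: "finite Z \<and> (\<forall>z\<in>Z. e z \<in> fs.span B) \<and>
        (\<forall>z\<in>Z. \<forall>y\<in>Z. e z y = (if z = y then 1 else 0)) \<and>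
        (\<forall>f\<in>fs.span B. \<forall>x. f x = (\<Sum>z\<in>Z. f z * e z x))"
      by (elim exE)
    then have Z: "finite Z" and e: "\<And>z. z \<in> Z \<Longrightarrow> e z \<in> fs.span B"
      and dual: "\<And>z y. z \<in> Z \<Longrightarrow> y \<in> Z \<Longrightarrow> e z y = (if z = y then 1 else 0)"
      and rep: "\<And>f x. f \<in> fs.span B \<Longrightarrow> f x = (\<Sum>z\<in>Z. f z * e z x)"
      by blast+
    define g where "g = (\<lambda>x. b x - (\<Sum>z\<in>Z. b z * e z x))"
    have comb: "(\<lambda>x. \<Sum>z\<in>Z. b z * e z x) \<in> fs.span B"
      by (intro fs_subspace_lincomb fs.subspace_span e)
    show ?case
    proof (cases "\<forall>x. g x = 0")
      case True
      then have "b = (\<lambda>x. \<Sum>z\<in>Z. b z * e z x)"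
        unfolding g_def by (intro ext) (metis right_minus_eq)
      then have "b \<in> fs.span B" using comb by metis
      then have "fs.span (insert b B) = fs.span B" by (rule fs.span_redundant)
      then show ?thesis using insert.IH by simp
    next
      case False
      then obtain w where w: "g w \<noteq> 0" by auto
      have gZ: "g y = 0" if "y \<in> Z" for y
      proof -
        have "(\<Sum>z\<in>Z. b z * e z y) = (\<Sum>z\<in>Z. if z = y then b z else 0)"
          by (intro sum.cong) (auto simp: dual that)
        then show ?thesis using that Z by (simp add: g_def)
      qed
      have wZ: "w \<notin> Z" using w gZ by auto
      have sub: "fs.span B \<subseteq> fs.span (insert b B)" by (rule fs.span_mono) auto
      have g: "g \<in> fs.span (insert b B)"
        unfolding g_def using comb sub fs.span_base[of b "insert b B"]
        by (intro fs_subspace_diff fs.subspace_span) auto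
      \<comment> \<open>The remainder \<open>g\<close> is normalised to take the value 1 at
        \<open>w\<close>; subtracting multiples of it makes the old \<open>e z\<close> vanish at
        \<open>w\<close> without changing them on \<open>Z\<close>.\<close>
      define e' where "e' = (\<lambda>z. if z = w then (\<lambda>x. (1 / g w) * g x) else (\<lambda>x. e z x - (e z w / g w) * g x))"
      have w1: "(\<lambda>x. c * g x) \<in> fs.span (insert b B)" for c
        using g by (rule fs.span_scale)
      have 1: "e' z \<in> fs.span (insert b B)" if z: "z \<in> insert w Z" for z
      proof (cases "z = w")
        case True
        then have eq: "e' z = (\<lambda>x. (1 / g w) * g x)" unfolding e'_def by (rule if_P)
        show ?thesis unfolding eq by (rule w1)
      next
        case False
        then have "e z \<in> fs.span (insert b B)" using z e sub by blast
        then have "(\<lambda>x. e z x - (e z w / g w) * g x) \<in> fs.span (insert b B)"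
          by (intro fs_subspace_diff fs.subspace_span w1)
        moreover have eq: "e' z = (\<lambda>x. e z x - (e z w / g w) * g x)"
          using False unfolding e'_def by (rule if_not_P)
        ultimately show ?thesis unfolding eq by blast
      qed
      have 2: "e' z y = (if z = y then 1 else 0)"
        if z: "z \<in> insert w Z" and y: "y \<in> insert w Z" for z y
        using z y w wZ gZ dual unfolding e'_def by auto
      have 3: "f x = (\<Sum>z\<in>insert w Z. f z * e' z x)" if f: "f \<in> fs.span (insert b B)" for f x
      proof -
        obtain k where k: "f - (\<lambda>x. k * b x) \<in> fs.span B"
          using f unfolding fs.span_breakdown_eq by blast
        \<comment> \<open>Since \<open>f - k * b\<close> lies in the old span, it equals its own
          interpolant; hence \<open>f = u + k * g\<close>.\<close>
        define u where "u = (\<lambda>x. \<Sum>z\<in>Z. f z * e z x)"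
        have fu: "f x = u x + k * g x" for x
          using rep[OF k, of x] unfolding u_def g_def
          by (simp add: algebra_simps sum.distrib sum_subtractf sum_distrib_left)
        have "(\<Sum>z\<in>insert w Z. f z * e' z x) = f w * (1 / g w * g x) + (\<Sum>z\<in>Z. f z * e' z x)"
          using Z wZ by (simp add: e'_def)
        also have "(\<Sum>z\<in>Z. f z * e' z x) = (\<Sum>z\<in>Z. f z * (e z x - (e z w / g w) * g x))"
          using wZ by (intro sum.cong) (auto simp: e'_def)
        also have "\<dots> = u x - u w / g w * g x"
          by (simp add: u_def algebra_simps sum_subtractf sum_distrib_left sum_divide_distrib)
        also have "f w * (1 / g w * g x) + (u x - u w / g w * g x) = f x"
          using w by (simp add: fu field_simps)
        finally show ?thesis by simp
      qed
      show ?thesis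
        by (intro exI[of _ "insert w Z"] exI[of _ e'] conjI ballI allI 1 2 3)
          (simp_all add: Z)
    qed
  qed
  then show ?thesis by (elim ex_forward conj_forward) auto
qed

lemma subspace_interpolation:
  fixes B :: "('a \<Rightarrow> real) set"
  assumes "finite B" "fs.subspace W" "W \<subseteq> fs.span B"
  obtains Z e where "finite Z" "\<And>z. z \<in> Z \<Longrightarrow> e z \<in> W"
    "\<And>f x. f \<in> W \<Longrightarrow> f x = (\<Sum>z\<in>Z. f z * e z x)"
proof -
  obtain C where C: "C \<subseteq> W" "fs.independent C" "W \<subseteq> fs.span C"
    using fs.maximal_independent_subset by metis
  have "finite C"
    using fs.independent_span_bound[OF assms(1) C(2)] C(1) assms(3) by auto
  moreover have "fs.span C = W"
    using C assms(2) fs.span_minimal by (metis subset_antisym)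
  ultimately show thesis
    using span_interpolation[of C] that by metis
qed

text \<open>Membership becomes an identity with finitely many terms that can be checked one point at
  a time and survives pointwise limits.\<close>

lemma interpolation_mem_iff:
  assumes "fs.subspace W" "\<And>z. z \<in> Z \<Longrightarrow> e z \<in> W"
    "\<And>f x. f \<in> W \<Longrightarrow> f x = (\<Sum>z\<in>Z. f z * e z x)"
  shows "g \<in> W \<longleftrightarrow> (\<forall>x. g x = (\<Sum>z\<in>Z. g z * e z x))"
proof
  assume "\<forall>x. g x = (\<Sum>z\<in>Z. g z * e z x)"
  then have "(\<lambda>x. \<Sum>z\<in>Z. g z * e z x) = g" by (intro ext) (erule allE, erule sym)
  moreover have "(\<lambda>x. \<Sum>z\<in>Z. g z * e z x) \<in> W"
    using assms(1,2) by (rule fs_subspace_lincomb)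
  ultimately show "g \<in> W" by simp
next
  assume "g \<in> W"
  then show "\<forall>x. g x = (\<Sum>z\<in>Z. g z * e z x)" by (intro allI assms(3))
qed

text \<open>Both sides of the interpolation identity converge at every point, so the identity holds
  for the limit; no norm has to be chosen on the space.\<close>

lemma pointwise_limit_mem_subspace:
  fixes B :: "('a \<Rightarrow> real) set"
  assumes "finite B" "fs.subspace W" "W \<subseteq> fs.span B"
    and ev: "eventually (\<lambda>a. F a \<in> W) A" and "A \<noteq> bot"
    and lim: "\<And>x. ((\<lambda>a. F a x) \<longlongrightarrow> g x) A"
  shows "g \<in> W"
proof -
  obtain Z e where Ze: "finite Z" "\<And>z. z \<in> Z \<Longrightarrow> e z \<in> W"
    "\<And>f x. f \<in> W \<Longrightarrow> f x = (\<Sum>z\<in>Z. f z * e z x)"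
    using subspace_interpolation[OF assms(1-3)] by metis
  have "g x = (\<Sum>z\<in>Z. g z * e z x)" for x
  proof (rule tendsto_unique[OF \<open>A \<noteq> bot\<close> lim])
    have "((\<lambda>a. \<Sum>z\<in>Z. F a z * e z x) \<longlongrightarrow> (\<Sum>z\<in>Z. g z * e z x)) A"
      by (intro tendsto_intros lim)
    moreover have "eventually (\<lambda>a. (\<Sum>z\<in>Z. F a z * e z x) = F a x) A"
      using ev by eventually_elim (simp flip: Ze(3))
    ultimately show "((\<lambda>a. F a x) \<longlongrightarrow> (\<Sum>z\<in>Z. g z * e z x)) A"
      by (rule Lim_transform_eventually)
  qed
  then show ?thesis
    using interpolation_mem_iff[of W Z e, OF assms(2) Ze(2,3)] by blast
qed

section \<open>Continuity\<close>

text \<open>The preimage of each basic open set is squeezed between a closed and an open set that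
  differ by small measure. Removing these countably many differences makes all the preimages
  relatively open.\<close>

lemma lusin:
  fixes f :: "'a::euclidean_space \<Rightarrow> 'b::second_countable_topology"
  assumes f: "f \<in> borel_measurable borel" and "0 < (\<epsilon>::real)"
  obtains U where "open U" "emeasure lborel U \<le> ennreal \<epsilon>" "continuous_on (- U) f"
proof -
  obtain B :: "'b set set" where B: "countable B" "topological_basis B"
    using ex_countable_basis by (elim exE conjE)
  have ne: "B \<noteq> {}"
    using topological_basisE[OF B(2) open_UNIV UNIV_I] by auto
  define V where "V = from_nat_into B"
  have V: "range V = B" unfolding V_def using B(1) ne by (simp add: range_from_nat_into)
  have opV: "open (V n)" for n
    using topological_basis_open[OF B(2)] V by blast
  have "\<exists>O' T. open O' \<and> closed T \<and> T \<subseteq> f -` V n \<and> f -` V n \<subseteq> O' \<and>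
      emeasure lborel (O' - T) \<le> ennreal (\<epsilon> * (1/2) ^ Suc n)" for n
  proof -
    define d where "d = \<epsilon> * (1/2) ^ Suc n / 2"
    have d: "d > 0" using assms by (simp add: d_def)
    have S: "f -` V n \<in> sets lebesgue"
      using measurable_sets[OF f borel_open[OF opV[of n]]] by (simp add: sets_completionI_sets)
    obtain O' where O': "open O'" "f -` V n \<subseteq> O'" "O' - f -` V n \<in> lmeasurable"
        "emeasure lebesgue (O' - f -` V n) < ennreal d"
      using sets_lebesgue_outer_open[OF S d] by metis
    obtain T where T: "closed T" "T \<subseteq> f -` V n" "f -` V n - T \<in> lmeasurable"
        "emeasure lebesgue (f -` V n - T) < ennreal d"
      using sets_lebesgue_inner_closed[OF S d] by metis
    have "O' - T = (O' - f -` V n) \<union> (f -` V n - T)" using O' T by auto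
    then have "emeasure lebesgue (O' - T) \<le> emeasure lebesgue (O' - f -` V n) + emeasure lebesgue (f -` V n - T)"
      by (simp only:) (rule emeasure_subadditive[OF fmeasurableD[OF O'(3)] fmeasurableD[OF T(3)]])
    also have "\<dots> \<le> ennreal d + ennreal d"
      using O'(4) T(4) by (intro add_mono) auto
    also have "\<dots> = ennreal (\<epsilon> * (1/2) ^ Suc n)"
      using d by (simp flip: ennreal_plus) (simp add: d_def)
    finally have "emeasure lborel (O' - T) \<le> ennreal (\<epsilon> * (1/2) ^ Suc n)"
      using O'(1) T(1) by (simp add: emeasure_completion)
    then show ?thesis using O' T by blast
  qed
  then obtain P T where P: "\<And>n. open (P n)" and T: "\<And>n. closed (T n)"
    and sub: "\<And>n. T n \<subseteq> f -` V n" "\<And>n. f -` V n \<subseteq> P n"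
    and em: "\<And>n. emeasure lborel (P n - T n) \<le> ennreal (\<epsilon> * (1/2) ^ Suc n)"
    by metis
  define U where "U = (\<Union>n. P n - T n)"
  show thesis
  proof
    show "open U" unfolding U_def using P T by (intro open_UN ballI open_Diff) auto
    have "emeasure lborel U \<le> (\<Sum>n. emeasure lborel (P n - T n))"
      unfolding U_def using P T by (intro emeasure_subadditive_countably) auto
    also have "\<dots> \<le> (\<Sum>n. ennreal (\<epsilon> * (1/2) ^ Suc n))"
      using em by (intro suminf_le) auto
    also have "\<dots> = ennreal \<epsilon>"
      using sums_mult[OF power_half_series, of \<epsilon>] assms by (intro suminf_ennreal_eq) auto
    finally show "emeasure lborel U \<le> ennreal \<epsilon>" .
    show "continuous_on (- U) f"
      unfolding continuous_on_open_invariant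
    proof (intro allI impI)
      fix C :: "'b set" assume "open C"
      have eq: "C = (\<Union>n\<in>{n. V n \<subseteq> C}. V n)"
      proof safe
        fix x assume "x \<in> C"
        then obtain b where "b \<in> B" "x \<in> b" "b \<subseteq> C"
          using topological_basisE[OF B(2) \<open>open C\<close>] by metis
        then show "x \<in> (\<Union>n\<in>{n. V n \<subseteq> C}. V n)" using V by auto
      qed auto
      have "P n \<inter> - U = f -` V n \<inter> - U" for n
        using sub[of n] by (auto simp: U_def)
      then have "(\<Union>n\<in>{n. V n \<subseteq> C}. P n) \<inter> - U = f -` (\<Union>n\<in>{n. V n \<subseteq> C}. V n) \<inter> - U"
        by blast
      then show "\<exists>A. open A \<and> A \<inter> - U = f -` C \<inter> - U"
        using P eq by (intro exI[of _ "\<Union>n\<in>{n. V n \<subseteq> C}. P n"]) auto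
    qed
  qed
qed

lemma lusin_finite:
  fixes F :: "'i \<Rightarrow> 'a::euclidean_space \<Rightarrow> 'b::second_countable_topology"
  assumes "finite I" "\<And>i. i \<in> I \<Longrightarrow> F i \<in> borel_measurable borel" "0 < (\<epsilon>::real)"
  obtains U where "open U" "emeasure lborel U \<le> ennreal \<epsilon>" "\<And>i. i \<in> I \<Longrightarrow> continuous_on (- U) (F i)"
proof -
  have "\<exists>U. open U \<and> emeasure lborel U \<le> ennreal \<epsilon> \<and> (\<forall>i\<in>I. continuous_on (- U) (F i))"
    using assms
  proof (induction I arbitrary: \<epsilon>)
    case empty
    show ?case by (rule exI[of _ "{}"]) auto
  next
    case (insert i I)
    obtain U where U: "open U" "emeasure lborel U \<le> ennreal (\<epsilon> / 2)" "\<forall>i\<in>I. continuous_on (- U) (F i)"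
      using insert.IH[of "\<epsilon> / 2"] insert.prems by auto
    obtain W where W: "open W" "emeasure lborel W \<le> ennreal (\<epsilon> / 2)" "continuous_on (- W) (F i)"
      using lusin[of "F i" "\<epsilon> / 2"] insert.prems by auto
    have "emeasure lborel (U \<union> W) \<le> emeasure lborel U + emeasure lborel W"
      using U W by (intro emeasure_subadditive) auto
    also have "\<dots> \<le> ennreal (\<epsilon> / 2) + ennreal (\<epsilon> / 2)"
      using U W by (intro add_mono)
    also have "\<dots> = ennreal \<epsilon>" using insert.prems by (simp flip: ennreal_plus)
    finally have "emeasure lborel (U \<union> W) \<le> ennreal \<epsilon>" .
    moreover have "\<forall>j\<in>insert i I. continuous_on (- (U \<union> W)) (F j)"
      using U(3) W(3) by (auto intro: continuous_on_subset)
    ultimately show ?case using U W by blast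
  qed
  then show thesis using that by blast
qed

text \<open>A quantitative form of Steinhaus' theorem.\<close>

lemma small_shift_meets:
  fixes U :: "real set"
  assumes "open U" "emeasure lborel U \<le> ennreal (1/4)" "\<bar>t\<bar> \<le> 1/4"
  obtains s where "s \<in> {0..1} - U" "s + t \<in> {0..1} - U"
proof -
  have "\<exists>s. s \<in> {0..1} - U \<and> s + t \<in> {0..1} - U"
  proof (rule ccontr)
    assume neg: "\<not> ?thesis"
    define W where "W = (\<lambda>s. t + s) -` U"
    have "open W" unfolding W_def using assms(1) by (intro open_vimage continuous_intros)
    then have "W \<in> sets borel" by simp
    have "emeasure lborel W = emeasure (distr lborel borel ((+) t)) U"
      unfolding W_def using assms(1) by (subst emeasure_distr) auto
    then have W: "emeasure lborel W \<le> ennreal (1/4)"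
      using assms(2) by (simp add: lborel_distr_plus)
    \<comment> \<open>For \<open>s\<close> in this interval both \<open>s\<close> and
      \<open>s + t\<close> lie in the unit interval. Its length \<open>1 - |t|\<close> is at least
      3/4, whereas \<open>U\<close> and \<open>W\<close> together have measure at most 1/2.\<close>
    have "{max 0 (- t)..min 1 (1 - t)} \<subseteq> U \<union> W"
      using neg by (fastforce simp: W_def add.commute)
    then have "emeasure lborel {max 0 (- t)..min 1 (1 - t)} \<le> emeasure lborel (U \<union> W)"
      using \<open>W \<in> sets borel\<close> assms(1) by (intro emeasure_mono) auto
    also have "\<dots> \<le> emeasure lborel U + emeasure lborel W"
      using \<open>W \<in> sets borel\<close> assms(1) by (intro emeasure_subadditive) auto
    also have "\<dots> \<le> ennreal (1/4) + ennreal (1/4)"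
      using W assms(2) by (intro add_mono)
    also have "\<dots> = ennreal (1/2)" by (simp flip: ennreal_plus)
    finally have "ennreal (min 1 (1 - t) - max 0 (- t)) \<le> ennreal (1/2)"
      using assms(3) by (subst (asm) emeasure_lborel_Icc) auto
    then have "min 1 (1 - t) - max 0 (- t) \<le> 1/2" by (subst (asm) ennreal_le_iff) auto
    then show False using assms(3) by linarith
  qed
  then show thesis using that by blast
qed

text \<open>On a compact set \<open>E\<close> of almost full measure in \<open>[0,1]\<close> the matrix coefficients of the
  translations are continuous by Lusin, and every small \<open>t\<close> is a difference of two points of \<open>E\<close>.\<close>

lemma translation_invariant_imp_continuous:
  fixes B :: "(real \<Rightarrow> real) set"
  assumes fin: "finite B"
    and meas: "\<And>f. f \<in> fs.span B \<Longrightarrow> f \<in> borel_measurable borel"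
    and trans: "\<And>f b. f \<in> fs.span B \<Longrightarrow> (\<lambda>x. f (x + b)) \<in> fs.span B"
    and f: "f \<in> fs.span B"
  shows "isCont f y"
proof -
  obtain Z e where Z: "finite Z" and e: "\<And>z. z \<in> Z \<Longrightarrow> e z \<in> fs.span B"
    and rep: "\<And>f x. f \<in> fs.span B \<Longrightarrow> f x = (\<Sum>z\<in>Z. f z * e z x)"
    by (rule subspace_interpolation[OF fin fs.subspace_span order_refl], rule that, assumption, blast, blast)
  have cont0: "isCont f 0" if f: "f \<in> fs.span B" for f
  proof -
    \<comment> \<open>The Boolean tag joins the translates of \<open>f\<close> and the reflected
      coefficients into one finite family, so that a single exceptional set serves both.\<close>
    define F where "F = (\<lambda>(b, z). if b then (\<lambda>t. f (z + t)) else (\<lambda>t. e z (- t)))"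
    have mf: "f \<in> borel_measurable borel" using f by (rule meas)
    have m1: "(\<lambda>t. f (z + t)) \<in> borel_measurable borel" for z
      by (rule measurable_compose[OF _ mf]) simp
    have m2: "(\<lambda>t. e z (- t)) \<in> borel_measurable borel" if "z \<in> Z" for z
      by (rule measurable_compose[OF _ meas[OF e[OF that]]]) simp
    have "F i \<in> borel_measurable borel" if "i \<in> (UNIV :: bool set) \<times> Z" for i
      using that m1 m2 by (auto simp: F_def split: prod.splits)
    then obtain U where U: "open U" "emeasure lborel U \<le> ennreal (1/4)"
      and contF: "\<And>i. i \<in> UNIV \<times> Z \<Longrightarrow> continuous_on (- U) (F i)"
      using lusin_finite[of "(UNIV :: bool set) \<times> Z" F "1/4"] Z by auto
    define E where "E = {0..1} - U"
    have "compact E" unfolding E_def using U(1) by (intro compact_diff) auto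
    have EU: "E \<subseteq> - U" by (auto simp: E_def)
    \<comment> \<open>Interpolating the translate of \<open>f\<close> by \<open>s'\<close> at the
      point \<open>- s\<close> writes \<open>f (s' - s)\<close> through functions of
      \<open>s\<close> and of \<open>s'\<close> separately, each continuous on
      \<open>E\<close>.\<close>
    define \<Phi> where "\<Phi> = (\<lambda>p. \<Sum>z\<in>Z. f (z + snd p) * e z (- fst p))"
    have \<Phi>: "\<Phi> (s, s') = f (s' - s)" for s s'
    proof -
      have "f (- s + s') = \<Phi> (s, s')"
        unfolding \<Phi>_def fst_conv snd_conv by (rule rep[OF trans[OF f]])
      then show ?thesis by simp
    qed
    have c1: "continuous_on E (\<lambda>t. f (z + t))" "continuous_on E (\<lambda>t. e z (- t))" if "z \<in> Z" for z
      using contF[of "(True, z)"] contF[of "(False, z)"] that EU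
      by (auto simp: F_def intro: continuous_on_subset)
    have "continuous_on (E \<times> E) \<Phi>"
      unfolding \<Phi>_def
      by (intro continuous_intros continuous_on_compose2[OF c1(1)] continuous_on_compose2[OF c1(2)]) auto
    then have "uniformly_continuous_on (E \<times> E) \<Phi>"
      using \<open>compact E\<close> by (intro compact_uniformly_continuous compact_Times)
    then have uc: "\<exists>d>0. \<forall>x\<in>E \<times> E. \<forall>x'\<in>E \<times> E. dist x' x < d \<longrightarrow> dist (\<Phi> x') (\<Phi> x) < r" if "r > 0" for r
      using that unfolding uniformly_continuous_on_def by blast
    show ?thesis
      unfolding continuous_at_eps_delta
    proof (intro allI impI)
      fix r :: real assume "r > 0"
      then obtain d where "d > 0" and d: "\<And>x x'. x \<in> E \<times> E \<Longrightarrow> x' \<in> E \<times> E \<Longrightarrow> dist x' x < d \<Longrightarrow> dist (\<Phi> x') (\<Phi> x) < r"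
        using uc by meson
      show "\<exists>d>0. \<forall>x'. dist x' 0 < d \<longrightarrow> dist (f x') (f 0) < r"
      proof (intro exI[of _ "min d (1/4)"] conjI allI impI)
        fix t :: real assume t: "dist t 0 < min d (1/4)"
        then obtain s where s: "s \<in> E" "s + t \<in> E"
          using small_shift_meets[OF U, of t] unfolding E_def by (auto simp: dist_real_def)
        \<comment> \<open>The two values are \<open>f t\<close> and \<open>f 0\<close>. The point
          \<open>s\<close> depends on \<open>t\<close>, which is why uniform continuity is
          used.\<close>
        have "dist (\<Phi> (s, s + t)) (\<Phi> (s, s)) < r"
          using s t by (intro d) (auto simp: dist_Pair_Pair dist_real_def)
        then show "dist (f t) (f 0) < r" by (simp add: \<Phi>)
      qed (use \<open>d > 0\<close> in auto)
    qed
  qed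
  have "isCont (\<lambda>x. f (x + y)) 0" by (intro cont0 trans f)
  then show ?thesis
    using isCont_o2[where a = y and f = "\<lambda>x. x - y" and g = "\<lambda>x. f (x + y)"] by simp
qed

section \<open>Smoothness and polynomials\<close>

lemma has_derivative_limit_of_quotients:
  fixes f :: "real \<Rightarrow> real"
  assumes "(f has_real_derivative D) (at x)"
  shows "((\<lambda>a. (f (x + a) - f x) / a) \<longlongrightarrow> D) (at 0)"
  using assms by (simp add: DERIV_def)

text \<open>The averages \<open>\<lambda>x. (F (x + a) - F x) / a\<close> of \<open>f\<close>, where \<open>F\<close> is an antiderivative, are
  continuously differentiable members of the space and converge to \<open>f\<close>.\<close>

lemma translation_invariant_imp_differentiable:
  fixes B :: "(real \<Rightarrow> real) set"
  assumes fin: "finite B"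
    and cont: "\<And>f x. f \<in> fs.span B \<Longrightarrow> isCont f x"
    and trans: "\<And>f b. f \<in> fs.span B \<Longrightarrow> (\<lambda>x. f (x + b)) \<in> fs.span B"
    and f: "f \<in> fs.span B"
  shows "\<exists>g\<in>fs.span B. \<forall>x. (f has_real_derivative g x) (at x)"
proof -
  obtain Z e where Z: "finite Z" and e: "\<And>z. z \<in> Z \<Longrightarrow> e z \<in> fs.span B"
    and rep: "\<And>f x. f \<in> fs.span B \<Longrightarrow> f x = (\<Sum>z\<in>Z. f z * e z x)"
    by (rule subspace_interpolation[OF fin fs.subspace_span order_refl], rule that, assumption, blast, blast)
  have mem_iff: "g \<in> fs.span B \<longleftrightarrow> (\<forall>x. g x = (\<Sum>z\<in>Z. g z * e z x))" for g
    using fs.subspace_span e rep by (rule interpolation_mem_iff)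
  \<comment> \<open>The differentiable members form a subspace of a finite-dimensional space, so
    they too are closed under pointwise limits.\<close>
  define W where "W = {f \<in> fs.span B. \<exists>g. \<forall>x. (f has_real_derivative g x) (at x)}"
  have subW: "fs.subspace W"
  proof (rule fs.subspaceI)
    show "0 \<in> W"
      unfolding W_def zero_fun_def[symmetric]
      using fs.span_zero[of B] by (auto simp: zero_fun_def intro!: exI[of _ "\<lambda>_. 0"])
  next
    fix u v assume "u \<in> W" "v \<in> W"
    then obtain u' v' where "\<forall>x. (u has_real_derivative u' x) (at x)" "\<forall>x. (v has_real_derivative v' x) (at x)"
      "u \<in> fs.span B" "v \<in> fs.span B" by (auto simp: W_def)
    then show "u + v \<in> W"
      unfolding W_def plus_fun_def using fs.span_add[of u B v, unfolded plus_fun_def]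
      by (auto intro!: exI[of _ "\<lambda>x. u' x + v' x"] derivative_intros)
  next
    fix c u assume "u \<in> W"
    then obtain u' where "\<forall>x. (u has_real_derivative u' x) (at x)" "u \<in> fs.span B"
      by (auto simp: W_def)
    then show "(\<lambda>x. c * u x) \<in> W"
      unfolding W_def using fs.span_scale[of u B c]
      by (auto intro!: exI[of _ "\<lambda>x. c * u' x"] DERIV_cmult)
  qed
  obtain F where F: "(F has_real_derivative f x) (at x)" for x
    using einterval_antiderivative[of "-\<infinity>" \<infinity> f] cont[OF f]
    by (auto simp: has_real_derivative_iff_has_vector_derivative)
  define S where "S = (\<lambda>a x. (F (x + a) - F x) / a)"
  have S_W: "S a \<in> W" if "a \<noteq> 0" for a
  proof -
    \<comment> \<open>Interpolation of the increments of \<open>F\<close>: both sides vanish at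
      \<open>a = 0\<close>, and their derivatives in \<open>a\<close> agree by the identity for
      translates of \<open>f\<close>.\<close>
    have diff: "F (x + a) - F x = (\<Sum>z\<in>Z. (F (z + a) - F z) * e z x)" for x
    proof -
      define \<phi> where "\<phi> = (\<lambda>a. (F (x + a) - F x) - (\<Sum>z\<in>Z. (F (z + a) - F z) * e z x))"
      have "(\<phi> has_real_derivative 0) (at a)" for a
      proof -
        have d: "((\<lambda>a. F (y + a)) has_real_derivative f (y + a)) (at a)" for y
          using F[of "y + a"] by (simp add: DERIV_shift add.commute)
        have "(\<phi> has_real_derivative (f (x + a) - 0) - (\<Sum>z\<in>Z. (f (z + a) - 0) * e z x)) (at a)"
          unfolding \<phi>_def
          by (intro DERIV_diff DERIV_sum DERIV_cmult_right d DERIV_const)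
        moreover have "f (x + a) = (\<Sum>z\<in>Z. f (z + a) * e z x)"
          by (rule rep[OF trans[OF f]])
        ultimately show ?thesis by simp
      qed
      then have "\<phi> a = \<phi> 0" by (intro DERIV_isconst_all) auto
      then show ?thesis by (simp add: \<phi>_def)
    qed
    have "S a x = (\<Sum>z\<in>Z. S a z * e z x)" for x
      unfolding S_def by (subst diff) (simp add: sum_divide_distrib)
    then have "S a \<in> fs.span B" using mem_iff by blast
    moreover have "(S a has_real_derivative (f (x + a) - f x) / a) (at x)" for x
      unfolding S_def using F[of "x + a"]
      by (intro DERIV_cdivide DERIV_diff F) (simp add: DERIV_shift)
    ultimately show ?thesis
      unfolding W_def by (auto intro!: exI[of _ "\<lambda>x. (f (x + a) - f x) / a"])
  qed
  \<comment> \<open>Taking the limit in \<open>W\<close> rather than in the whole span is what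
    yields differentiability of \<open>f\<close>; pointwise convergence of the averages is
    enough.\<close>
  have "f \<in> W"
  proof (rule pointwise_limit_mem_subspace[OF fin subW, of S "at 0"])
    show "W \<subseteq> fs.span B" by (auto simp: W_def)
    show "\<forall>\<^sub>F a in at 0. S a \<in> W"
      using S_W by (auto simp: eventually_at_filter)
    show "((\<lambda>a. S a x) \<longlongrightarrow> f x) (at 0)" for x
      unfolding S_def by (rule has_derivative_limit_of_quotients[OF F])
  qed simp
  then obtain g where g: "\<And>x. (f has_real_derivative g x) (at x)"
    by (auto simp: W_def)
  have "g \<in> fs.span B"
  proof (rule pointwise_limit_mem_subspace[OF fin fs.subspace_span order_refl, of "\<lambda>a x. (1 / a) * (f (x + a) - f x)" "at 0"])
    show "\<forall>\<^sub>F a in at 0. (\<lambda>x. (1 / a) * (f (x + a) - f x)) \<in> fs.span B"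
      by (intro always_eventually allI fs.span_scale fs_subspace_diff fs.subspace_span trans f)
    show "((\<lambda>a. (1 / a) * (f (x + a) - f x)) \<longlongrightarrow> g x) (at 0)" for x
      using has_derivative_limit_of_quotients[OF g, of x] by simp
  qed simp
  then show ?thesis using g by blast
qed

section \<open>Monomials and Taylor expansions\<close>

lemma independent_monomials: "fs.independent ((\<lambda>l (x::real). x ^ l) ` {..n})"
  and inj_on_monomials: "inj (\<lambda>l (x::real). x ^ l)"
proof -
  show inj: "inj (\<lambda>l (x::real). x ^ l)"
  proof (rule injI)
    fix i j assume "(\<lambda>x::real. x ^ i) = (\<lambda>x. x ^ j)"
    from fun_cong[OF this, of 2] show "i = j" by simp
  qed
  show "fs.independent ((\<lambda>l (x::real). x ^ l) ` {..n})"
  proof (rule fs.independent_if_scalars_zero)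
    fix c :: "(real \<Rightarrow> real) \<Rightarrow> real" and p :: "real \<Rightarrow> real"
    assume 0: "(\<Sum>p\<in>(\<lambda>l (x::real). x ^ l) ` {..n}. (\<lambda>x. c p * p x)) = 0"
      and p: "p \<in> (\<lambda>l x. x ^ l) ` {..n}"
    have "(\<Sum>l\<le>n. c (\<lambda>x. x ^ l) * x ^ l) = 0" for x
      using fun_cong[OF 0, of x]
      by (simp add: sum_fun_eval sum.reindex[OF inj_on_subset[OF inj]])
    then have "\<forall>l\<le>n. c (\<lambda>x. x ^ l) = 0"
      using polyfun_eq_0[of "\<lambda>l. c (\<lambda>x. x ^ l)" n] by blast
    then show "c p = 0" using p by auto
  qed simp
qed

text \<open>If \<open>x ^ n\<close> is the first monomial missing from the space, then the limit of
  \<open>(f (a x) - T (a x)) / a ^ n\<close> as \<open>a\<close> tends to \<open>0\<close>, with \<open>T\<close> the Taylor polynomial of order \<open>n\<close>,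
  is a multiple of \<open>x ^ n\<close> lying in the space; hence the \<open>n\<close>-th derivative vanishes at \<open>0\<close>.\<close>

lemma dilation_invariant_deriv_eq_0:
  fixes B :: "(real \<Rightarrow> real) set"
  assumes fin: "finite B"
    and dil: "\<And>f a. f \<in> fs.span B \<Longrightarrow> 0 < a \<Longrightarrow> a < 1 \<Longrightarrow> (\<lambda>x. f (a * x)) \<in> fs.span B"
    and mono: "\<And>l. l < n \<Longrightarrow> (\<lambda>x. x ^ l) \<in> fs.span B" "(\<lambda>x. x ^ n) \<notin> fs.span B"
    and D: "D 0 \<in> fs.span B" "\<And>m x. (D m has_real_derivative D (Suc m) x) (at x)"
  shows "D n 0 = 0"
proof (rule ccontr)
  assume nz: "D n 0 \<noteq> 0"
  define T where "T = (\<lambda>a x. (1 / a ^ n) * (D 0 (a * x) - (\<Sum>m<n. (D m 0 / fact m * a ^ m) * x ^ m)))"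
  \<comment> \<open>Lagrange's form of the remainder: the intermediate point is at most
    \<open>a * |x|\<close> in absolute value, hence tends to 0 with \<open>a\<close>.\<close>
  have T: "\<exists>t. \<bar>t\<bar> \<le> a * \<bar>x\<bar> \<and> T a x = D n t / fact n * x ^ n" if "a > 0" for a x
  proof -
    obtain t where t: "\<bar>t\<bar> \<le> \<bar>a * x\<bar>"
      "D 0 (a * x) = (\<Sum>m<n. D m 0 / fact m * (a * x) ^ m) + D n t / fact n * (a * x) ^ n"
      using Maclaurin_all_le[of D "D 0" "a * x" n] D(2) by blast
    have "T a x = D n t / fact n * x ^ n"
      unfolding T_def t(2) using that by (simp add: power_mult_distrib mult.assoc)
    then show ?thesis using t(1) that by (auto simp: abs_mult)
  qed
  define g where "g = (\<lambda>x::real. D n 0 / fact n * x ^ n)"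
  have "g \<in> fs.span B"
  proof (rule pointwise_limit_mem_subspace[OF fin fs.subspace_span order_refl, of T "at_right 0"])
    \<comment> \<open>The subtracted Taylor polynomial has degree below \<open>n\<close>, so it lies
      in the span by the choice of \<open>n\<close>.\<close>
    have "T a \<in> fs.span B" if "0 < a" "a < 1" for a
      unfolding T_def
      by (intro fs.span_scale fs_subspace_diff fs_subspace_lincomb fs.subspace_span dil D that mono) auto
    then show "\<forall>\<^sub>F a in at_right 0. T a \<in> fs.span B"
      using eventually_at_right_less[of "0::real"] eventually_at_right_real[of 0 "1::real"]
      by (auto elim: eventually_mono)
    show "((\<lambda>a. T a x) \<longlongrightarrow> g x) (at_right 0)" for x
    proof -
      obtain \<tau> where \<tau>: "\<And>a. a > 0 \<Longrightarrow> \<bar>\<tau> a\<bar> \<le> a * \<bar>x\<bar>" "\<And>a. a > 0 \<Longrightarrow> T a x = D n (\<tau> a) / fact n * x ^ n"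
        using T[of _ x] by metis
      have pos: "\<forall>\<^sub>F a in at_right (0::real). 0 < a" by (rule eventually_at_right_less)
      have "((\<lambda>a. a * \<bar>x\<bar>) \<longlongrightarrow> 0) (at_right 0)"
        by (auto intro!: tendsto_eq_intros)
      then have "(\<tau> \<longlongrightarrow> 0) (at_right 0)"
        by (rule Lim_null_comparison[rotated]) (use pos \<tau>(1) in \<open>auto elim!: eventually_mono\<close>)
      moreover have "isCont (D n) 0" using D(2) DERIV_isCont by blast
      ultimately have "((\<lambda>a. D n (\<tau> a)) \<longlongrightarrow> D n 0) (at_right 0)"
        by (rule isCont_tendsto_compose[rotated])
      then have "((\<lambda>a. D n (\<tau> a) / fact n * x ^ n) \<longlongrightarrow> g x) (at_right 0)"
        unfolding g_def by (intro tendsto_intros) auto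
      moreover have "\<forall>\<^sub>F a in at_right 0. D n (\<tau> a) / fact n * x ^ n = T a x"
        using pos by (rule eventually_mono) (simp add: \<tau>(2))
      ultimately show ?thesis by (rule Lim_transform_eventually)
    qed
  qed simp
  then have "(\<lambda>x. (fact n / D n 0) * g x) \<in> fs.span B" by (rule fs.span_scale)
  moreover have "(\<lambda>x. (fact n / D n 0) * g x) = (\<lambda>x. x ^ n)"
    using nz by (simp add: g_def)
  ultimately show False using mono(2) by simp
qed

lemma affine_invariant_imp_polynomials:
  fixes B :: "(real \<Rightarrow> real) set"
  assumes fin: "finite B"
    and meas: "\<And>f. f \<in> fs.span B \<Longrightarrow> f \<in> borel_measurable borel"
    and one: "(\<lambda>_. 1) \<in> fs.span B"
    and trans: "\<And>f b. f \<in> fs.span B \<Longrightarrow> (\<lambda>x. f (x + b)) \<in> fs.span B"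
    and dil: "\<And>f a. f \<in> fs.span B \<Longrightarrow> 0 < a \<Longrightarrow> a < 1 \<Longrightarrow> (\<lambda>x. f (a * x)) \<in> fs.span B"
  shows "\<exists>L. Suc L \<le> card B \<and> fs.span B = fs.span ((\<lambda>l x. x ^ l) ` {..L})"
proof -
  have bound: "Suc n \<le> card B" if "\<And>l. l \<le> n \<Longrightarrow> (\<lambda>x. x ^ l) \<in> fs.span B" for n
  proof -
    have "card ((\<lambda>l (x::real). x ^ l) ` {..n}) \<le> card B"
      using fs.independent_span_bound[OF fin independent_monomials] that by blast
    then show ?thesis
      by (simp add: card_image inj_on_subset[OF inj_on_monomials])
  qed
  \<comment> \<open>Otherwise the span of \<open>B\<close> would contain \<open>card B + 1\<close>
    independent monomials.\<close>
  have "\<exists>n. (\<lambda>x. x ^ n) \<notin> fs.span B"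
    using bound[of "card B"] by (meson not_less_eq_eq order_refl)
  define n where "n = (LEAST n. (\<lambda>x. x ^ n) \<notin> fs.span B)"
  have n: "(\<lambda>x. x ^ n) \<notin> fs.span B"
    unfolding n_def using \<open>\<exists>n. _\<close> by (rule LeastI_ex)
  have less: "(\<lambda>x. x ^ l) \<in> fs.span B" if "l < n" for l
    using not_less_Least[of l] that unfolding n_def by blast
  \<comment> \<open>Constants belong to the span, so the first missing degree is positive and its
    predecessor \<open>L\<close> exists.\<close>
  have "n \<noteq> 0" using one n by (auto simp: power_0[abs_def] intro: ccontr)
  then obtain L where L: "n = Suc L" by (cases n) auto
  have cont: "isCont f x" if "f \<in> fs.span B" for f x
    by (rule translation_invariant_imp_continuous[OF fin meas trans that])
  have "\<forall>f\<in>fs.span B. \<exists>g\<in>fs.span B. \<forall>x. (f has_real_derivative g x) (at x)"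
    using translation_invariant_imp_differentiable[OF fin cont trans] by blast
  then obtain d where d: "\<And>f. f \<in> fs.span B \<Longrightarrow> d f \<in> fs.span B"
      "\<And>f x. f \<in> fs.span B \<Longrightarrow> (f has_real_derivative d f x) (at x)"
    by metis
  have poly: "f \<in> fs.span ((\<lambda>l x. x ^ l) ` {..L})" if f: "f \<in> fs.span B" for f
  proof -
    define D where "D = (\<lambda>m. (d ^^ m) f)"
    have "D m \<in> fs.span B" for m
      by (induction m) (auto simp: D_def f d)
    then have D: "(D m has_real_derivative D (Suc m) x) (at x)" for m x
      using d(2)[of "D m"] by (simp add: D_def)
    have D0: "D 0 = f" by (simp add: D_def)
    have zero: "D n b = 0" for b
    proof -
      \<comment> \<open>The derivatives at 0 of the translate by \<open>b\<close> are those of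
        \<open>f\<close> at \<open>b\<close>.\<close>
      have "(\<lambda>x. D n (x + b)) 0 = 0"
      proof (rule dilation_invariant_deriv_eq_0[OF fin dil less n, where D = "\<lambda>m x. D m (x + b)"])
        show "(\<lambda>x. D 0 (x + b)) \<in> fs.span B" unfolding D0 by (rule trans[OF f])
        show "((\<lambda>x. D m (x + b)) has_real_derivative D (Suc m) (x + b)) (at x)" for m x
          using D[of m "x + b"] by (simp add: DERIV_shift)
      qed
      then show ?thesis by simp
    qed
    have eq: "f x = (\<Sum>m\<in>{..L}. (D m 0 / fact m) * x ^ m)" for x
    proof -
      obtain t where "f x = (\<Sum>m<n. D m 0 / fact m * x ^ m) + D n t / fact n * x ^ n"
        using Maclaurin_all_le[of D f x n] D D0 by blast
      then have "f x = (\<Sum>m<n. D m 0 / fact m * x ^ m)" by (simp add: zero)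
      then show ?thesis by (simp only: L lessThan_Suc_atMost)
    qed
    have "(\<lambda>x. \<Sum>m\<in>{..L}. (D m 0 / fact m) * x ^ m) \<in> fs.span ((\<lambda>l x. x ^ l) ` {..L})"
      by (intro fs_subspace_lincomb fs.subspace_span fs.span_base) auto
    moreover have "(\<lambda>x. \<Sum>m\<in>{..L}. (D m 0 / fact m) * x ^ m) = f"
      by (intro ext) (rule eq[symmetric])
    ultimately show ?thesis by simp
  qed
  have "fs.span B = fs.span ((\<lambda>l x. x ^ l) ` {..L})"
  proof
    show "fs.span B \<subseteq> fs.span ((\<lambda>l x. x ^ l) ` {..L})" using poly by blast
    show "fs.span ((\<lambda>l x. x ^ l) ` {..L}) \<subseteq> fs.span B"
      using less L by (intro fs.span_minimal fs.subspace_span) auto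
  qed
  moreover have "Suc L \<le> card B" using less L by (intro bound) auto
  ultimately show ?thesis by blast
qed

section \<open>A three-state chain\<close>

lemma distr_pair_measure_snd:
  assumes "prob_space N" "prob_space M"
  shows "distr (N \<Otimes>\<^sub>M M) M snd = M"
proof (rule measure_eqI)
  interpret N: prob_space N by fact
  interpret M: prob_space M by fact
  fix A assume "A \<in> sets (distr (N \<Otimes>\<^sub>M M) M snd)"
  then have A: "A \<in> sets M" by simp
  have "snd -` A \<inter> space (N \<Otimes>\<^sub>M M) = space N \<times> A"
    using sets.sets_into_space[OF A] by (auto simp: space_pair_measure)
  then show "emeasure (distr (N \<Otimes>\<^sub>M M) M snd) A = emeasure M A"
    using A by (simp add: emeasure_distr M.emeasure_pair_measure_Times N.emeasure_space_1)
qed simp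

section \<open>Laws and measurability of the coordinates of the trajectory space\<close>

locale mdp =
  fixes nX nA :: nat and p :: "nat \<Rightarrow> nat \<Rightarrow> nat pmf" and R :: "nat \<Rightarrow> nat \<Rightarrow> real measure"
    and pol :: "nat \<Rightarrow> nat pmf"
  assumes wf: "wf_mdp nX nA p R pol"
begin

abbreviation "\<Omega> \<equiv> traj_space nX nA p R pol"
abbreviation "S \<equiv> step_space nX nA p R pol"
abbreviation "SR \<equiv> (\<Pi>\<^sub>M xa\<in>{..<nX} \<times> {..<nA}. R (fst xa) (snd xa))"
abbreviation "SP \<equiv> (\<Pi>\<^sub>M xa\<in>{..<nX} \<times> {..<nA}. measure_pmf (p (fst xa) (snd xa)))"
abbreviation "SA \<equiv> (\<Pi>\<^sub>M x\<in>{..<nX}. measure_pmf (pol x))"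

lemma reward_law: "x < nX \<Longrightarrow> a < nA \<Longrightarrow> prob_space (R x a)" "x < nX \<Longrightarrow> a < nA \<Longrightarrow> sets (R x a) = sets borel"
  using wf by (auto simp: wf_mdp_def)

lemma prob_space_factors: "prob_space SR" "prob_space SP" "prob_space SA"
  by (intro prob_space_PiM; auto intro: reward_law measure_pmf.prob_space_axioms)+

lemma S_eq: "S = SR \<Otimes>\<^sub>M (SP \<Otimes>\<^sub>M SA)"
  by (simp add: step_space_def)

lemma prob_space_S: "prob_space S"
  unfolding S_eq by (intro prob_space_pair prob_space_factors)

lemma prob_space_\<Omega>: "prob_space \<Omega>"
  unfolding traj_space_def by (intro prob_space_PiM prob_space_S)

lemma measurable_coord: "(\<lambda>\<omega>. \<omega> t) \<in> \<Omega> \<rightarrow>\<^sub>M S"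
  unfolding traj_space_def by simp

lemma distr_coord: "distr \<Omega> S (\<lambda>\<omega>. \<omega> t) = S"
  unfolding traj_space_def by (rule distr_PiM_component) (auto intro: prob_space_S)

lemma measurable_reward_coord: "(\<lambda>\<omega>. fst (\<omega> t)) \<in> \<Omega> \<rightarrow>\<^sub>M SR"
  and measurable_trans_coord: "(\<lambda>\<omega>. fst (snd (\<omega> t))) \<in> \<Omega> \<rightarrow>\<^sub>M SP"
  and measurable_pol_coord: "(\<lambda>\<omega>. snd (snd (\<omega> t))) \<in> \<Omega> \<rightarrow>\<^sub>M SA"
  using measurable_coord[of t] unfolding S_eq by measurable

lemma distr_reward_coord: "distr \<Omega> SR (\<lambda>\<omega>. fst (\<omega> t)) = SR"
proof -
  interpret P: prob_space "SP \<Otimes>\<^sub>M SA" by (intro prob_space_pair prob_space_factors)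
  have "distr \<Omega> SR (\<lambda>\<omega>. fst (\<omega> t)) = distr (distr \<Omega> S (\<lambda>\<omega>. \<omega> t)) SR fst"
    using measurable_coord[of t] by (subst distr_distr) (auto simp: S_eq comp_def)
  then show ?thesis by (simp only: distr_coord) (simp only: S_eq P.distr_pair_fst)
qed

lemma distr_trans_pol_coord: "distr \<Omega> (SP \<Otimes>\<^sub>M SA) (\<lambda>\<omega>. snd (\<omega> t)) = SP \<Otimes>\<^sub>M SA"
proof -
  have "distr \<Omega> (SP \<Otimes>\<^sub>M SA) (\<lambda>\<omega>. snd (\<omega> t)) = distr (distr \<Omega> S (\<lambda>\<omega>. \<omega> t)) (SP \<Otimes>\<^sub>M SA) snd"
    using measurable_coord[of t] by (subst distr_distr) (auto simp: S_eq comp_def)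
  then show ?thesis
    by (simp only: distr_coord)
       (simp only: S_eq distr_pair_measure_snd prob_space_pair prob_space_factors)
qed

lemma measurable_trans_pol_coord: "(\<lambda>\<omega>. snd (\<omega> t)) \<in> \<Omega> \<rightarrow>\<^sub>M SP \<Otimes>\<^sub>M SA"
  using measurable_coord[of t] unfolding S_eq by measurable

lemma distr_trans_coord: "distr \<Omega> SP (\<lambda>\<omega>. fst (snd (\<omega> t))) = SP"
proof -
  interpret A: prob_space SA by (rule prob_space_factors)
  have "distr \<Omega> SP (\<lambda>\<omega>. fst (snd (\<omega> t))) = distr (distr \<Omega> (SP \<Otimes>\<^sub>M SA) (\<lambda>\<omega>. snd (\<omega> t))) SP fst"
    using measurable_trans_pol_coord[of t] by (subst distr_distr) (auto simp: comp_def)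
  then show ?thesis by (simp only: distr_trans_pol_coord A.distr_pair_fst)
qed

lemma distr_pol_coord: "distr \<Omega> SA (\<lambda>\<omega>. snd (snd (\<omega> t))) = SA"
proof -
  have "distr \<Omega> SA (\<lambda>\<omega>. snd (snd (\<omega> t))) = distr (distr \<Omega> (SP \<Otimes>\<^sub>M SA) (\<lambda>\<omega>. snd (\<omega> t))) SA snd"
    using measurable_trans_pol_coord[of t] by (subst distr_distr) (auto simp: comp_def)
  then show ?thesis
    by (simp only: distr_trans_pol_coord distr_pair_measure_snd prob_space_factors)
qed

lemma measurable_reward:
  assumes "x < nX" "a < nA"
  shows "(\<lambda>\<omega>. fst (\<omega> t) (x, a)) \<in> \<Omega> \<rightarrow>\<^sub>M R x a"
  using measurable_compose[OF measurable_reward_coord[of t] measurable_component_singleton[of "(x, a)"]] assms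
  by auto

lemma distr_reward:
  assumes "x < nX" "a < nA"
  shows "distr \<Omega> (R x a) (\<lambda>\<omega>. fst (\<omega> t) (x, a)) = R x a"
proof -
  have "(\<lambda>f. f (x, a)) \<in> SR \<rightarrow>\<^sub>M R x a"
    using measurable_component_singleton[of "(x, a)" "{..<nX} \<times> {..<nA}" "\<lambda>xa. R (fst xa) (snd xa)"] assms by simp
  then have "distr \<Omega> (R x a) (\<lambda>\<omega>. fst (\<omega> t) (x, a)) = distr (distr \<Omega> SR (\<lambda>\<omega>. fst (\<omega> t))) (R x a) (\<lambda>f. f (x, a))"
    using measurable_reward_coord[of t] by (subst distr_distr) (auto simp: comp_def)
  also have "\<dots> = R x a"
  proof -
    have "distr SR (R (fst (x, a)) (snd (x, a))) (\<lambda>f. f (x, a)) = R (fst (x, a)) (snd (x, a))"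
      by (rule distr_PiM_component) (use assms in \<open>auto intro!: reward_law(1)\<close>)
    then show ?thesis by (simp only: distr_reward_coord fst_conv snd_conv)
  qed
  finally show ?thesis .
qed

lemma AE_reward:
  assumes "x < nX" "a < nA" "AE z in R x a. P z"
  shows "AE \<omega> in \<Omega>. P (fst (\<omega> t) (x, a))"
  by (rule AE_distrD[OF measurable_reward]) (simp_all only: distr_reward assms)

lemma AE_trans:
  assumes "x < nX" "a < nA" "AE y in measure_pmf (p x a). P y"
  shows "AE \<omega> in \<Omega>. P (fst (snd (\<omega> t)) (x, a))"
proof (rule AE_distrD[OF measurable_trans_coord])
  have "AE f in SP. P (f (x, a))"
    by (rule AE_PiM_component[where i = "(x, a)" and P = P])
      (simp_all only: fst_conv snd_conv assms, simp_all add: assms measure_pmf.prob_space_axioms)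
  then show "AE f in distr \<Omega> SP (\<lambda>\<omega>. fst (snd (\<omega> t))). P (f (x, a))"
    by (simp only: distr_trans_coord)
qed

lemma AE_pol:
  assumes "x < nX" "AE y in measure_pmf (pol x). P y"
  shows "AE \<omega> in \<Omega>. P (snd (snd (\<omega> t)) x)"
proof (rule AE_distrD[OF measurable_pol_coord])
  have "AE f in SA. P (f x)"
    by (rule AE_PiM_component[where i = x and P = P])
      (use assms in \<open>simp_all add: measure_pmf.prob_space_axioms\<close>)
  then show "AE f in distr \<Omega> SA (\<lambda>\<omega>. snd (snd (\<omega> t))). P (f x)"
    by (simp only: distr_pol_coord)
qed

text \<open>Outside the index set a product coordinate is the constant \<open>undefined\<close>.\<close>

lemma measurable_PiM_any_coord:
  assumes "\<And>i. i \<in> I \<Longrightarrow> sets (N i) = sets L" "undefined \<in> space L"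
  shows "(\<lambda>f. f i) \<in> PiM I N \<rightarrow>\<^sub>M L"
proof (cases "i \<in> I")
  case True
  then have "(\<lambda>f. f i) \<in> PiM I N \<rightarrow>\<^sub>M N i" by simp
  then show ?thesis using measurable_cong_sets[OF refl assms(1)[OF True]] by blast
next
  case False
  have "(\<lambda>f. f i) \<in> PiM I N \<rightarrow>\<^sub>M L \<longleftrightarrow> (\<lambda>f. undefined) \<in> PiM I N \<rightarrow>\<^sub>M L"
    by (rule measurable_cong) (metis PiE_arb False space_PiM)
  then show ?thesis using assms(2) by simp
qed

text \<open>The table entry that is read depends on the random current state. As there are only
  countably many states, measurability of each fixed entry suffices.\<close>

lemma measurable_sa: "(\<lambda>\<omega>. sa \<omega> x a t) \<in> \<Omega> \<rightarrow>\<^sub>M count_space UNIV"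
proof (induction t)
  case 0
  show ?case by simp
next
  case (Suc t)
  have "(\<lambda>\<omega>. fst (snd (\<omega> t)) i) \<in> \<Omega> \<rightarrow>\<^sub>M count_space UNIV" for i
    by (rule measurable_compose[OF measurable_trans_coord measurable_PiM_any_coord]) auto
  then have 1: "(\<lambda>\<omega>. fst (snd (\<omega> t)) (sa \<omega> x a t)) \<in> \<Omega> \<rightarrow>\<^sub>M count_space UNIV"
    by (rule measurable_compose_countable[OF _ Suc.IH])
  have "(\<lambda>\<omega>. snd (snd (\<omega> t)) i) \<in> \<Omega> \<rightarrow>\<^sub>M count_space UNIV" for i
    by (rule measurable_compose[OF measurable_pol_coord measurable_PiM_any_coord]) auto
  then have 2: "(\<lambda>\<omega>. snd (snd (\<omega> t)) (fst (snd (\<omega> t)) (sa \<omega> x a t))) \<in> \<Omega> \<rightarrow>\<^sub>M count_space UNIV"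
    by (rule measurable_compose_countable[OF _ 1])
  have "(\<lambda>\<omega>. (fst (snd (\<omega> t)) (sa \<omega> x a t), j)) \<in> \<Omega> \<rightarrow>\<^sub>M count_space UNIV" for j :: nat
    by (rule measurable_compose[OF 1]) simp
  then have "(\<lambda>\<omega>. (fst (snd (\<omega> t)) (sa \<omega> x a t), snd (snd (\<omega> t)) (fst (snd (\<omega> t)) (sa \<omega> x a t))))
      \<in> \<Omega> \<rightarrow>\<^sub>M count_space UNIV"
    by (rule measurable_compose_countable[OF _ 2])
  then show ?case by (simp add: Let_def)
qed

lemma measurable_rew: "(\<lambda>\<omega>. rew \<omega> x a t) \<in> borel_measurable \<Omega>"
proof -
  have "(\<lambda>\<omega>. fst (\<omega> t) i) \<in> borel_measurable \<Omega>" for i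
    by (rule measurable_compose[OF measurable_reward_coord measurable_PiM_any_coord])
      (simp_all add: reward_law(2) mem_Times_iff)
  then show ?thesis
    unfolding rew_def by (rule measurable_compose_countable[OF _ measurable_sa])
qed

lemma measurable_return: "(\<lambda>\<omega>. \<Sum>t. \<gamma> ^ t * rew \<omega> x a t) \<in> borel_measurable \<Omega>"
  by (intro borel_measurable_suminf borel_measurable_times measurable_rew borel_measurable_const)

end

text \<open>State \<open>0\<close> pays \<open>r\<close>, state \<open>1\<close> pays a reward with law \<open>q\<close>, and state \<open>2\<close> is absorbing
  without reward; so the return from \<open>0\<close> is \<open>r + \<gamma> Z\<close> with \<open>Z\<close> distributed as \<open>q\<close>.\<close>

definition chain_p :: "nat \<Rightarrow> nat \<Rightarrow> nat pmf" where
  "chain_p x a = return_pmf (min (x + 1) 2)"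

definition chain_pol :: "nat \<Rightarrow> nat pmf" where
  "chain_pol x = return_pmf 0"

text \<open>The image under \<open>id\<close> only moves \<open>q\<close> from the discrete to the
  Borel sigma-algebra, as \<open>wf_mdp\<close> requires.\<close>

definition chain_R :: "real \<Rightarrow> real pmf \<Rightarrow> nat \<Rightarrow> nat \<Rightarrow> real measure" where
  "chain_R r q x a = (if x = 0 then return borel r else if x = 1 then distr (measure_pmf q) borel id
     else return borel 0)"

context
  fixes r :: real and q :: "real pmf"
begin

interpretation chain: mdp 3 1 chain_p "chain_R r q" chain_pol
  by unfold_locales
    (auto simp: wf_mdp_def chain_p_def chain_pol_def chain_R_def prob_space_return
      intro!: measure_pmf.prob_space_distr)

lemma wf_chain: "wf_mdp 3 1 chain_p (chain_R r q) chain_pol"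
  by (rule chain.wf)

abbreviation "chain_space \<equiv> traj_space 3 1 chain_p (chain_R r q) chain_pol"

text \<open>Transitions, actions and the rewards of states 0 and 2 are point masses, and there are
  countably many draws. Off one null set, only the reward of state 1 remains random.\<close>

lemma AE_chain:
  "AE \<omega> in chain_space. (\<forall>t x. x < 3 \<longrightarrow> sa \<omega> x 0 t = (min (x + t) 2, 0)) \<and>
     (\<forall>t. fst (\<omega> t) (0, 0) = r \<and> fst (\<omega> t) (2, 0) = 0)"
proof -
  have p: "AE \<omega> in chain_space. \<forall>t. \<forall>x\<in>{..<3}. fst (snd (\<omega> t)) (x, 0) = min (x + 1) 2"
    unfolding AE_all_countable
    by (intro allI AE_finite_allI chain.AE_trans) (auto simp: chain_p_def AE_measure_pmf_iff)
  have pol: "AE \<omega> in chain_space. \<forall>t. \<forall>x\<in>{..<3}. snd (snd (\<omega> t)) x = 0"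
    unfolding AE_all_countable
    by (intro allI AE_finite_allI chain.AE_pol) (auto simp: chain_pol_def AE_measure_pmf_iff)
  have R: "chain_R r q 0 0 = return borel r" "chain_R r q 2 0 = return borel 0"
    by (simp_all add: chain_R_def)
  have r: "AE \<omega> in chain_space. \<forall>t. fst (\<omega> t) (0, 0) = r"
    unfolding AE_all_countable
    by (intro allI chain.AE_reward[where P = "\<lambda>z. z = r"]) (simp_all only: R, simp_all add: AE_return)
  have z: "AE \<omega> in chain_space. \<forall>t. fst (\<omega> t) (2, 0) = 0"
    unfolding AE_all_countable
    by (intro allI chain.AE_reward[where P = "\<lambda>z. z = 0"]) (simp_all only: R, simp_all add: AE_return)
  show ?thesis
    using p pol r z
  proof eventually_elim
    case (elim \<omega>)
    have "sa \<omega> x 0 t = (min (x + t) 2, 0)" if "x < 3" for x t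
      using that by (induction t) (use elim in \<open>auto simp: Let_def\<close>)
    then show ?case using elim by auto
  qed
qed

text \<open>From time 2 on the chain sits in the unpaid state 2, so only the first two rewards
  count, whatever the starting state.\<close>

lemma chain_return_sums:
  assumes "\<And>t x. x < 3 \<Longrightarrow> sa \<omega> x 0 t = (min (x + t) 2, 0)" "\<And>t. fst (\<omega> t) (2, 0) = 0" "x < 3"
  shows "(\<lambda>t. \<gamma> ^ t * rew \<omega> x 0 t) sums
    (fst (\<omega> 0) (x, 0) + \<gamma> * fst (\<omega> 1) (min (x + 1) 2, 0))"
proof -
  have "(\<lambda>t. \<gamma> ^ t * rew \<omega> x 0 t) sums (\<Sum>t\<in>{..<2}. \<gamma> ^ t * rew \<omega> x 0 t)"
  proof (rule sums_finite)
    fix t assume "t \<notin> {..<2::nat}"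
    then have "sa \<omega> x 0 t = (2, 0)" using assms(1)[OF assms(3), of t] by simp
    then show "\<gamma> ^ t * rew \<omega> x 0 t = 0" by (simp add: rew_def assms(2))
  qed simp
  moreover have "min x 2 = x" using assms(3) by simp
  ultimately show ?thesis
    using assms(1)[OF assms(3), of 0] assms(1)[OF assms(3), of 1]
    by (simp add: rew_def numeral_2_eq_2 del: sa.simps)
qed

lemma AE_chain_return:
  assumes "x < 3"
  shows "AE \<omega> in chain_space. (\<lambda>t. \<gamma> ^ t * rew \<omega> x 0 t) sums
    (fst (\<omega> 0) (x, 0) + \<gamma> * fst (\<omega> 1) (min (x + 1) 2, 0))"
  using AE_chain by eventually_elim (intro chain_return_sums assms; blast)

lemma distr_chain_reward:
  assumes "f \<in> borel_measurable borel"
  shows "distr chain_space borel (\<lambda>\<omega>. f (fst (\<omega> t) (1, 0))) = distr (measure_pmf q) borel f"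
proof -
  have m: "(\<lambda>\<omega>. fst (\<omega> t) (1, 0)) \<in> chain_space \<rightarrow>\<^sub>M chain_R r q 1 0"
    by (rule chain.measurable_reward) auto
  have f: "f \<in> chain_R r q 1 0 \<rightarrow>\<^sub>M borel" using assms by (simp add: chain_R_def)
  have "distr chain_space borel (\<lambda>\<omega>. f (fst (\<omega> t) (1, 0)))
      = distr (distr chain_space (chain_R r q 1 0) (\<lambda>\<omega>. fst (\<omega> t) (1, 0))) borel f"
    using m f by (subst distr_distr) (auto simp: comp_def)
  also have "\<dots> = distr (chain_R r q 1 0) borel f"
    by (subst chain.distr_reward) auto
  also have "\<dots> = distr (measure_pmf q) borel f"
    using assms by (simp add: chain_R_def distr_distr comp_def)
  finally show ?thesis .
qed

lemma ret_dist_chain_eq: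
  assumes "x < 3" "g \<in> borel_measurable chain_space"
    and "AE \<omega> in chain_space. fst (\<omega> 0) (x, 0) + \<gamma> * fst (\<omega> 1) (min (x + 1) 2, 0) = g \<omega>"
  shows "ret_dist 3 1 chain_p (chain_R r q) chain_pol \<gamma> x 0 = distr chain_space borel g"
  unfolding ret_dist_def
proof (rule distr_cong_AE[OF refl refl])
  show "AE \<omega> in chain_space. (\<Sum>t. \<gamma> ^ t * rew \<omega> x 0 t) = g \<omega>"
    using AE_chain_return[OF assms(1), of \<gamma>] assms(3) by eventually_elim (auto simp: sums_iff)
qed (use assms chain.measurable_return in auto)

lemma ret_dist_chain:
  "ret_dist 3 1 chain_p (chain_R r q) chain_pol \<gamma> 0 0 = distr (measure_pmf q) borel (\<lambda>z. r + \<gamma> * z)"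
  "ret_dist 3 1 chain_p (chain_R r q) chain_pol \<gamma> 1 0 = distr (measure_pmf q) borel id"
  "ret_dist 3 1 chain_p (chain_R r q) chain_pol \<gamma> 2 0 = return borel 0"
proof -
  have m: "(\<lambda>\<omega>. fst (\<omega> t) (1, 0)) \<in> borel_measurable chain_space" for t
    using chain.measurable_reward[of 1 0 t] by (simp add: chain_R_def)
  have "ret_dist 3 1 chain_p (chain_R r q) chain_pol \<gamma> 0 0
      = distr chain_space borel (\<lambda>\<omega>. r + \<gamma> * fst (\<omega> 1) (1, 0))"
  proof (rule ret_dist_chain_eq)
    show "AE \<omega> in chain_space. fst (\<omega> 0) (0, 0) + \<gamma> * fst (\<omega> 1) (min (0 + 1) 2, 0) = r + \<gamma> * fst (\<omega> 1) (1, 0)"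
      using AE_chain by eventually_elim simp
  qed (use m in auto)
  then show "ret_dist 3 1 chain_p (chain_R r q) chain_pol \<gamma> 0 0
      = distr (measure_pmf q) borel (\<lambda>z. r + \<gamma> * z)"
    by (simp add: distr_chain_reward[of "\<lambda>z. r + \<gamma> * z"] del: One_nat_def)
  have "ret_dist 3 1 chain_p (chain_R r q) chain_pol \<gamma> 1 0
      = distr chain_space borel (\<lambda>\<omega>. id (fst (\<omega> 0) (1, 0)))"
  proof (rule ret_dist_chain_eq)
    show "AE \<omega> in chain_space. fst (\<omega> 0) (1, 0) + \<gamma> * fst (\<omega> 1) (min (1 + 1) 2, 0) = id (fst (\<omega> 0) (1, 0))"
      using AE_chain by eventually_elim (simp add: numeral_2_eq_2)
  qed (use m in auto)
  also have "\<dots> = distr (measure_pmf q) borel id"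
    by (rule distr_chain_reward) simp
  finally show "ret_dist 3 1 chain_p (chain_R r q) chain_pol \<gamma> 1 0 = distr (measure_pmf q) borel id" .
  have "ret_dist 3 1 chain_p (chain_R r q) chain_pol \<gamma> 2 0 = distr chain_space borel (\<lambda>\<omega>. 0)"
  proof (rule ret_dist_chain_eq)
    show "AE \<omega> in chain_space. fst (\<omega> 0) (2, 0) + \<gamma> * fst (\<omega> 1) (min (2 + 1) 2, 0) = 0"
      using AE_chain by eventually_elim simp
  qed auto
  also have "\<dots> = return borel 0"
    by (rule prob_space.distr_const[OF chain.prob_space_\<Omega>]) simp
  finally show "ret_dist 3 1 chain_p (chain_R r q) chain_pol \<gamma> 2 0 = return borel 0" .
qed

text \<open>The first reward and the successor of state 0 are almost surely constant. Thus the
  argument of the Bellman map depends on \<open>q\<close> only through its statistics.\<close>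

lemma next_law_chain:
  "next_law h K \<gamma> 3 1 chain_p (chain_R r q) chain_pol 0 0
     = return borel (r, stat h K (distr (measure_pmf q) borel id))"
proof -
  have "next_law h K \<gamma> 3 1 chain_p (chain_R r q) chain_pol 0 0
      = distr chain_space borel (\<lambda>_. (r, stat h K (distr (measure_pmf q) borel id)))"
    unfolding next_law_def
  proof (rule distr_cong_AE[OF refl refl])
    show "AE \<omega> in chain_space. (rew \<omega> 0 0 0, stat h K (ret_dist 3 1 chain_p (chain_R r q) chain_pol \<gamma>
        (fst (sa \<omega> 0 0 1)) (snd (sa \<omega> 0 0 1)))) = (r, stat h K (distr (measure_pmf q) borel id))"
      using AE_chain
    proof eventually_elim
      case (elim \<omega>)
      then have "sa \<omega> 0 0 1 = (1, 0)" by (simp del: sa.simps)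
      moreover have "rew \<omega> 0 0 0 = r" using elim by (simp add: rew_def)
      ultimately show ?case by (simp only: fst_conv snd_conv ret_dist_chain)
    qed
    show "(\<lambda>\<omega>. (rew \<omega> 0 0 0, stat h K (ret_dist 3 1 chain_p (chain_R r q) chain_pol \<gamma>
        (fst (sa \<omega> 0 0 1)) (snd (sa \<omega> 0 0 1))))) \<in> borel_measurable chain_space"
      by (intro borel_measurable_Pair chain.measurable_rew measurable_compose[OF chain.measurable_sa]) simp
  qed simp
  also have "\<dots> = return borel (r, stat h K (distr (measure_pmf q) borel id))"
    by (rule prob_space.distr_const[OF chain.prob_space_\<Omega>]) simp
  finally show ?thesis .
qed

text \<open>Finite support makes every expectation finite, and each reward series has at most two
  nonzero terms. Admissibility concerns all three starting states.\<close>

lemma admissible_chain: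
  assumes meas: "\<And>k. k \<in> {1..K} \<Longrightarrow> h k \<in> borel_measurable borel" and fin: "finite (set_pmf q)"
  shows "admissible_mdp h K \<gamma> 3 1 chain_p (chain_R r q) chain_pol"
proof -
  have dom: "distr (measure_pmf q') borel f \<in> stat_dom h K"
    if "finite (set_pmf q')" for f and q' :: "real pmf"
    using that unfolding stat_dom_def
    by (auto intro!: measure_pmf.prob_space_distr integrable_measure_pmf_finite
        simp: integrable_distr_eq meas)
  have "return borel 0 \<in> stat_dom h K"
    using dom[of "return_pmf 0" id] by (simp add: return_pmf.rep_eq distr_return)
  then have "ret_dist 3 1 chain_p (chain_R r q) chain_pol \<gamma> x 0 \<in> stat_dom h K" if "x < 3" for x
  proof -
    from that consider "x = 0" | "x = 1" | "x = 2" by linarith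
    then show ?thesis
      by cases (use \<open>return borel 0 \<in> _\<close> in \<open>simp_all only: ret_dist_chain dom fin\<close>)
  qed
  moreover have "AE \<omega> in chain_space. summable (\<lambda>t. \<gamma> ^ t * rew \<omega> x 0 t)" if "x < 3" for x
    using AE_chain_return[OF that, of \<gamma>] by eventually_elim (auto simp: sums_iff)
  ultimately show ?thesis
    unfolding admissible_mdp_def using wf_chain by auto
qed

end

text \<open>The chains with reward laws \<mu> and \<nu> in state 1 feed the same point mass to
  \<open>G\<close>, so the returns from state 0 have equal statistics.\<close>

lemma bellman_closed_affine:
  assumes meas: "\<And>k. k \<in> {1..K} \<Longrightarrow> h k \<in> borel_measurable borel"
    and closed: "bellman_closed h K" and \<gamma>: "0 \<le> \<gamma>" "\<gamma> < 1"
    and fin: "finite (set_pmf \<mu>)" "finite (set_pmf \<nu>)"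
    and eq: "\<And>k. k \<in> {1..K} \<Longrightarrow> measure_pmf.expectation \<mu> (h k) = measure_pmf.expectation \<nu> (h k)"
    and k: "k \<in> {1..K}"
  shows "measure_pmf.expectation \<mu> (\<lambda>z. h k (r + \<gamma> * z)) = measure_pmf.expectation \<nu> (\<lambda>z. h k (r + \<gamma> * z))"
proof -
  obtain G where G: "\<And>nX nA p R pol x a. admissible_mdp h K \<gamma> nX nA p R pol \<Longrightarrow> x < nX \<Longrightarrow> a < nA \<Longrightarrow>
      stat h K (ret_dist nX nA p R pol \<gamma> x a) = G (next_law h K \<gamma> nX nA p R pol x a)"
    using closed \<gamma> unfolding bellman_closed_def by metis
  have G': "stat h K (distr (measure_pmf q) borel (\<lambda>z. r + \<gamma> * z))
      = G (return borel (r, stat h K (distr (measure_pmf q) borel id)))" if "finite (set_pmf q)" for q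
    using G[OF admissible_chain[OF meas that], of 0 0 r] unfolding ret_dist_chain next_law_chain by simp
  have "stat h K (distr (measure_pmf \<mu>) borel id) = stat h K (distr (measure_pmf \<nu>) borel id)"
    using eq meas by (auto simp: stat_def fun_eq_iff integral_distr)
  then have "stat h K (distr (measure_pmf \<mu>) borel (\<lambda>z. r + \<gamma> * z))
      = stat h K (distr (measure_pmf \<nu>) borel (\<lambda>z. r + \<gamma> * z))"
    by (simp add: G' fin)
  from fun_cong[OF this, of k] show ?thesis
    using k meas by (simp add: stat_def integral_distr)
qed

section \<open>From Bellman closedness to affine invariance\<close>

lemma finite_support_pmf:
  fixes w :: "'a \<Rightarrow> real"
  assumes "finite A" "\<And>y. 0 \<le> w y" "\<And>y. y \<notin> A \<Longrightarrow> w y = 0" "(\<Sum>y\<in>A. w y) = 1"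
  obtains q where "finite (set_pmf q)"
    "\<And>f :: 'a \<Rightarrow> real. measure_pmf.expectation q f = (\<Sum>y\<in>A. w y * f y)"
proof -
  have "(\<integral>\<^sup>+y. ennreal (w y) \<partial>count_space UNIV) = (\<Sum>y\<in>A. ennreal (w y))"
    using assms(1,3) by (intro nn_integral_count_space'[of A]) auto
  also have "\<dots> = 1" using assms(2,4) by simp
  finally have w: "(\<integral>\<^sup>+y. ennreal (w y) \<partial>count_space UNIV) = 1" .
  have pmf: "pmf (embed_pmf w) y = w y" for y
    by (rule pmf_embed_pmf[OF assms(2) w])
  have set: "set_pmf (embed_pmf w) \<subseteq> A"
    using assms(3) by (auto simp: set_pmf_eq pmf)
  show thesis
  proof
    show "finite (set_pmf (embed_pmf w))" using set assms(1) finite_subset by blast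
    show "measure_pmf.expectation (embed_pmf w) f = (\<Sum>y\<in>A. w y * f y)" for f :: "'a \<Rightarrow> real"
      using set by (subst integral_measure_pmf[OF assms(1)]) (auto simp: pmf)
  qed
qed

text \<open>A signed measure of total mass zero is a multiple of a difference of probability measures.\<close>

lemma bellman_closed_signed:
  assumes meas: "\<And>k. k \<in> {1..K} \<Longrightarrow> h k \<in> borel_measurable borel"
    and closed: "bellman_closed h K" and \<gamma>: "0 \<le> \<gamma>" "\<gamma> < 1"
    and A: "finite A" and c0: "(\<Sum>y\<in>A. c y) = 0"
    and c: "\<And>k. k \<in> {1..K} \<Longrightarrow> (\<Sum>y\<in>A. c y * h k y) = 0"
    and k: "k \<in> {1..K}"
  shows "(\<Sum>y\<in>A. c y * h k (r + \<gamma> * y)) = 0"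
proof -
  define C where "C = (\<Sum>y\<in>A. max 0 (c y))"
  have split: "(\<Sum>y\<in>A. c y * f y) = (\<Sum>y\<in>A. max 0 (c y) * f y) - (\<Sum>y\<in>A. max 0 (- c y) * f y)" for f
    unfolding sum_subtractf[symmetric] by (intro sum.cong) (auto simp: max_def)
  \<comment> \<open>Total mass zero means that the positive and the negative part have the same mass
    \<open>C\<close>, so one constant normalises both.\<close>
  have C': "(\<Sum>y\<in>A. max 0 (- c y)) = C"
    using split[of "\<lambda>_. 1"] c0 by (simp add: C_def)
  have "C \<ge> 0" unfolding C_def by (intro sum_nonneg) auto
  show ?thesis
  proof (cases "C = 0")
    case True
    then have "max 0 (c y) = 0" "max 0 (- c y) = 0" if "y \<in> A" for y
      using C' that A by (auto simp: C_def sum_nonneg_eq_0_iff)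
    then have "c y = 0" if "y \<in> A" for y
      using that by (fastforce simp: max_def split: if_splits)
    then show ?thesis by simp
  next
    case False
    with \<open>C \<ge> 0\<close> have "C > 0" by simp
    obtain \<mu> where \<mu>: "finite (set_pmf \<mu>)"
      "\<And>f :: real \<Rightarrow> real. measure_pmf.expectation \<mu> f = (\<Sum>y\<in>A. (if y \<in> A then max 0 (c y) / C else 0) * f y)"
      by (rule finite_support_pmf[OF A, of "\<lambda>y. if y \<in> A then max 0 (c y) / C else 0"])
        (use \<open>C > 0\<close> in \<open>auto simp: C_def simp flip: sum_divide_distrib\<close>)
    obtain \<nu> where \<nu>: "finite (set_pmf \<nu>)"
      "\<And>f :: real \<Rightarrow> real. measure_pmf.expectation \<nu> f = (\<Sum>y\<in>A. (if y \<in> A then max 0 (- c y) / C else 0) * f y)"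
      by (rule finite_support_pmf[OF A, of "\<lambda>y. if y \<in> A then max 0 (- c y) / C else 0"])
        (use \<open>C > 0\<close> C' in \<open>auto simp flip: sum_divide_distrib\<close>)
    have diff: "measure_pmf.expectation \<mu> f - measure_pmf.expectation \<nu> f = (\<Sum>y\<in>A. c y * f y) / C" for f
      unfolding \<mu> \<nu> split diff_divide_distrib sum_divide_distrib by (simp cong: sum.cong)
    have "measure_pmf.expectation \<mu> (\<lambda>z. h k (r + \<gamma> * z)) = measure_pmf.expectation \<nu> (\<lambda>z. h k (r + \<gamma> * z))"
    proof (rule bellman_closed_affine[OF meas closed \<gamma> \<mu>(1) \<nu>(1) _ k])
      show "measure_pmf.expectation \<mu> (h j) = measure_pmf.expectation \<nu> (h j)" if "j \<in> {1..K}" for j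
        using diff[of "h j"] c[OF that] by simp
    qed
    then show ?thesis using diff[of "\<lambda>z. h k (r + \<gamma> * z)"] \<open>C > 0\<close> by simp
  qed
qed

abbreviation stat_funs :: "(nat \<Rightarrow> real \<Rightarrow> real) \<Rightarrow> nat \<Rightarrow> (real \<Rightarrow> real) set" where
  "stat_funs h K \<equiv> {\<lambda>_. 1} \<union> h ` {1..K}"

text \<open>For fixed \<open>x\<close> the interpolation formula gives a finitely supported signed measure
  \<open>\<delta>\<^sub>x - (\<Sum>z\<in>Z. e z x \<delta>\<^sub>z)\<close> annihilating the span; by closedness it annihilates
  \<open>y \<mapsto> h k (r + \<gamma> y)\<close> too.\<close>

lemma bellman_closed_affine_invariant:
  assumes meas: "\<And>k. k \<in> {1..K} \<Longrightarrow> h k \<in> borel_measurable borel"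
    and closed: "bellman_closed h K" and \<gamma>: "0 \<le> \<gamma>" "\<gamma> < 1"
    and f: "f \<in> fs.span (stat_funs h K)"
  shows "(\<lambda>x. f (r + \<gamma> * x)) \<in> fs.span (stat_funs h K)"
proof -
  let ?V = "fs.span (stat_funs h K)"
  have fin: "finite (stat_funs h K)" by simp
  obtain Z e where Z: "finite Z" and e: "\<And>z. z \<in> Z \<Longrightarrow> e z \<in> ?V"
    and rep: "\<And>f x. f \<in> ?V \<Longrightarrow> f x = (\<Sum>z\<in>Z. f z * e z x)"
    by (rule subspace_interpolation[OF fin fs.subspace_span order_refl], rule that, assumption, blast, blast)
  have mem_iff: "g \<in> ?V \<longleftrightarrow> (\<forall>x. g x = (\<Sum>z\<in>Z. g z * e z x))" for g
    using fs.subspace_span e rep by (rule interpolation_mem_iff)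
  have h: "(\<lambda>x. h k (r + \<gamma> * x)) \<in> ?V" if k: "k \<in> {1..K}" for k
    unfolding mem_iff
  proof
    fix x
    \<comment> \<open>The weights of the point mass at \<open>x\<close> minus its interpolating
      combination of point masses; two separate conditionals allow \<open>x\<close> to be a node
      itself.\<close>
    define c where "c = (\<lambda>y. (if y = x then 1 else 0) - (if y \<in> Z then e y x else 0))"
    define A where "A = insert x Z"
    have A: "finite A" using Z by (simp add: A_def)
    have c: "(\<Sum>y\<in>A. c y * f y) = f x - (\<Sum>z\<in>Z. f z * e z x)" for f
    proof -
      have "(\<Sum>y\<in>A. c y * f y) = (\<Sum>y\<in>A. if y = x then f y else 0) - (\<Sum>y\<in>A. if y \<in> Z then f y * e y x else 0)"
        unfolding sum_subtractf[symmetric] by (intro sum.cong) (auto simp: c_def algebra_simps)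
      also have "(\<Sum>y\<in>A. if y = x then f y else 0) = f x"
        using A by (simp add: A_def)
      also have "(\<Sum>y\<in>A. if y \<in> Z then f y * e y x else 0) = (\<Sum>z\<in>Z. f z * e z x)"
        using A by (intro sum.mono_neutral_cong_right) (auto simp: A_def)
      finally show ?thesis .
    qed
    have c_V: "(\<Sum>y\<in>A. c y * f y) = 0" if "f \<in> ?V" for f
      unfolding c using rep[OF that, of x] by (simp only: right_minus_eq)
    have "(\<Sum>y\<in>A. c y * h k (r + \<gamma> * y)) = 0"
    proof (rule bellman_closed_signed[OF meas closed \<gamma> A _ _ k])
      show "(\<Sum>y\<in>A. c y) = 0"
        using c_V[of "\<lambda>_. 1"] fs.span_base[of "\<lambda>_. 1" "stat_funs h K"] by simp
      show "(\<Sum>y\<in>A. c y * h j y) = 0" if "j \<in> {1..K}" for j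
        using that by (intro c_V fs.span_base) auto
    qed
    then show "h k (r + \<gamma> * x) = (\<Sum>z\<in>Z. h k (r + \<gamma> * z) * e z x)"
      unfolding c[of "\<lambda>y. h k (r + \<gamma> * y)"] by (simp only: right_minus_eq)
  qed
  show ?thesis
    using f
  proof (induction rule: fs.span_induct_alt)
    case base
    show ?case using fs.span_zero[of "stat_funs h K"] by (simp add: zero_fun_def)
  next
    case (step c b g)
    \<comment> \<open>A generator is either some \<open>h k\<close> or the constant 1, which the
      substitution leaves unchanged.\<close>
    have "(\<lambda>x. b (r + \<gamma> * x)) \<in> ?V"
      using step(1) h fs.span_base[of "\<lambda>_. 1" "stat_funs h K"] by auto
    from fs.span_add[OF fs.span_scale[OF this, of c] step(2)]
    show ?case by (simp add: plus_fun_def)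
  qed
qed

text \<open>Dilations by \<open>1/2\<close> are injective on a finite-dimensional space, hence surjective.\<close>

lemma dilation_invariant_imp_double:
  fixes B :: "(real \<Rightarrow> real) set"
  assumes fin: "finite B"
    and half: "\<And>f. f \<in> fs.span B \<Longrightarrow> (\<lambda>x. f (x / 2)) \<in> fs.span B"
    and f: "f \<in> fs.span B"
  shows "(\<lambda>x. f (2 * x)) \<in> fs.span B"
proof -
  define D where "D = (\<lambda>(f :: real \<Rightarrow> real) x. f (x / 2))"
  interpret D: Vector_Spaces.linear "\<lambda>(c::real) (f::real \<Rightarrow> real) x. c * f x" "\<lambda>(c::real) (f::real \<Rightarrow> real) x. c * f x" D
    by unfold_locales (auto simp: D_def fun_eq_iff)
  have inj: "inj D"
  proof (rule injI)
    fix f g assume "D f = D g"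
    have "f x = g x" for x using fun_cong[OF \<open>D f = D g\<close>, of "2 * x"] by (simp add: D_def)
    then show "f = g" by (rule ext)
  qed
  obtain C where C: "C \<subseteq> fs.span B" "fs.independent C" "fs.span B \<subseteq> fs.span C"
    using fs.maximal_independent_subset by metis
  have finC: "finite C" using fs.independent_span_bound[OF fin C(2,1)] by simp
  have span_C: "fs.span C = fs.span B"
    using C fs.span_minimal[OF C(1) fs.subspace_span] by blast
  have ind: "fs.independent (D ` C)"
    using D.independent_injective_image[OF C(2) inj_on_subset[OF inj]] by simp
  \<comment> \<open>The image of the basis \<open>C\<close> is independent and has as many elements
    as \<open>C\<close>; adjoining an \<open>f\<close> outside its span would exceed the
    dimension.\<close>
  have "f \<in> fs.span (D ` C)"
  proof (rule ccontr)
    assume notin: "f \<notin> fs.span (D ` C)"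
    then have "fs.independent (insert f (D ` C))" using ind by (rule fs.independent_insertI)
    moreover have "insert f (D ` C) \<subseteq> fs.span C"
      using f half C(1) by (auto simp: span_C D_def)
    ultimately have "card (insert f (D ` C)) \<le> card C"
      using fs.independent_span_bound[OF finC] by blast
    moreover have "f \<notin> D ` C" using notin fs.span_base by blast
    moreover have "card (D ` C) = card C"
      using inj_on_subset[OF inj subset_UNIV] by (rule card_image)
    ultimately show False using finC by simp
  qed
  then have "f \<in> D ` fs.span C" by (simp add: D.span_image)
  then obtain g where "g \<in> fs.span B" "f = D g" using span_C by auto
  then show ?thesis by (simp add: D_def)
qed

lemma bellman_closed_span_monomials:
  assumes meas: "\<And>k. k \<in> {1..K} \<Longrightarrow> h k \<in> borel_measurable borel"
    and closed: "bellman_closed h K"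
  obtains L where "L \<le> K" "fs.span (stat_funs h K) = fs.span ((\<lambda>l x. x ^ l) ` {..L})"
proof -
  let ?V = "fs.span (stat_funs h K)"
  have fin: "finite (stat_funs h K)" by simp
  have aff: "(\<lambda>x. f (r + \<gamma> * x)) \<in> ?V" if "f \<in> ?V" "0 \<le> \<gamma>" "\<gamma> < 1" for f r \<gamma>
    using bellman_closed_affine_invariant[OF meas closed that(2,3,1)] .
  have dil: "(\<lambda>x. f (a * x)) \<in> ?V" if "f \<in> ?V" "0 < a" "a < 1" for f a
    using aff[OF that(1), of a 0] that by simp
  have trans: "(\<lambda>x. f (x + b)) \<in> ?V" if "f \<in> ?V" for f b
  proof -
    \<comment> \<open>The factor 1 is not an admissible discount, so the translation is composed of
      doubling and the map sending \<open>x\<close> to \<open>b / 2 + x / 2\<close>.\<close>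
    have "(\<lambda>x. f (2 * x)) \<in> ?V"
      using dil[of _ "1/2"] that by (intro dilation_invariant_imp_double[OF fin]) auto
    from aff[OF this, of "1/2" "b / 2"] show ?thesis
      by (simp add: algebra_simps)
  qed
  have m: "f \<in> borel_measurable borel" if "f \<in> ?V" for f
    using that
  proof (induction rule: fs.span_induct_alt)
    case (step c b g)
    then have "b \<in> borel_measurable borel" using meas by auto
    with step(2) show ?case by (simp add: plus_fun_def)
  qed (simp add: zero_fun_def)
  have "(\<lambda>_. 1) \<in> ?V" by (rule fs.span_base) simp
  from affine_invariant_imp_polynomials[OF fin m this trans dil]
  obtain L where L: "Suc L \<le> card (stat_funs h K)" "?V = fs.span ((\<lambda>l x. x ^ l) ` {..L})"
    by blast
  \<comment> \<open>The constant adds at most one generator to the \<open>h k\<close>, which turns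
    \<open>Suc L \<le> card\<close> into \<open>L \<le> K\<close>.\<close>
  have "card (stat_funs h K) \<le> Suc (card (h ` {1..K}))"
    by (simp add: card_insert_le_m1 card_insert_if)
  also have "card (h ` {1..K}) \<le> K"
    using card_image_le[of "{1..K}" h] by simp
  finally have "L \<le> K" using L(1) by simp
  then show thesis using L(2) that by blast
qed

section \<open>From spans of functions to spans of functionals\<close>

lemma integrable_fs_span:
  assumes "f \<in> fs.span S" "\<And>g. g \<in> S \<Longrightarrow> integrable \<mu> g"
  shows "integrable \<mu> f"
  using assms(1)
proof (induction rule: fs.span_induct_alt)
  case (step c b g)
  then show ?case using assms(2) by (simp add: plus_fun_def)
qed (simp add: zero_fun_def)

text \<open>The integral is additive only on integrable functions, so integrability is carried along
  in the induction; off \<open>D\<close> all functionals are zero by \<open>on_dom\<close>.\<close>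

lemma integral_functional_fs_span:
  assumes f: "f \<in> fs.span S" and int: "\<And>g \<mu>. g \<in> S \<Longrightarrow> \<mu> \<in> D \<Longrightarrow> integrable \<mu> g"
  shows "on_dom D (\<lambda>\<mu>. \<integral>z. f z \<partial>\<mu>) \<in> fs.span ((\<lambda>g. on_dom D (\<lambda>\<mu>. \<integral>z. g z \<partial>\<mu>)) ` S)"
proof -
  let ?\<Phi> = "\<lambda>g. on_dom D (\<lambda>\<mu>. \<integral>z. g z \<partial>\<mu>)"
  have "(\<forall>\<mu>\<in>D. integrable \<mu> f) \<and> ?\<Phi> f \<in> fs.span (?\<Phi> ` S)"
    using f
  proof (induction rule: fs.span_induct_alt)
    case base
    show ?case
      using fs.span_zero[of "?\<Phi> ` S"] by (simp add: zero_fun_def on_dom_def)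
  next
    case (step c b g)
    have "?\<Phi> ((\<lambda>x. c * b x) + g) = (\<lambda>\<mu>. c * ?\<Phi> b \<mu>) + ?\<Phi> g"
      using int[OF step(1)] step(2) by (auto simp: fun_eq_iff on_dom_def)
    also have "\<dots> \<in> fs.span (?\<Phi> ` S)"
      using step by (intro fs.span_add fs.span_scale) (auto intro: fs.span_base)
    finally show ?case
      using int[OF step(1)] step(2) by (simp add: plus_fun_def)
  qed
  then show ?thesis by blast
qed

theorem theorem1:
  fixes h :: "nat \<Rightarrow> real \<Rightarrow> real" and K :: nat
  assumes meas: "\<And>k. k \<in> {1..K} \<Longrightarrow> h k \<in> borel_measurable borel"
    and closed: "bellman_closed h K"
  shows "\<exists>L\<le>K.
           (\<forall>\<mu>\<in>stat_dom h K. \<forall>l\<le>L. integrable \<mu> (\<lambda>z. z ^ l)) \<and>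
           fspan ({on_dom (stat_dom h K) (\<lambda>\<mu>. 1)} \<union>
                  (\<lambda>k. on_dom (stat_dom h K) (\<lambda>\<mu>. \<integral>z. h k z \<partial>\<mu>)) ` {1..K})
           = fspan ((\<lambda>l. on_dom (stat_dom h K) (moment l)) ` {0..L})"
proof -
  obtain L where L: "L \<le> K" and eq: "fs.span (stat_funs h K) = fs.span ((\<lambda>l x. x ^ l) ` {..L})"
    using bellman_closed_span_monomials[OF meas closed] by metis
  let ?D = "stat_dom h K" and ?M = "(\<lambda>l (x::real). x ^ l) ` {..L}"
  define \<Phi> where "\<Phi> = (\<lambda>g. on_dom ?D (\<lambda>\<mu>. \<integral>z. g z \<partial>\<mu>))"
  have int_h: "integrable \<mu> g" if "g \<in> stat_funs h K" "\<mu> \<in> ?D" for g \<mu>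
  proof -
    interpret prob_space \<mu> using that(2) by (simp add: stat_dom_def)
    show ?thesis using that by (auto simp: stat_dom_def)
  qed
  \<comment> \<open>Monomials up to degree \<open>L\<close> are combinations of 1 and the
    \<open>h k\<close>; hence the moments are finite on the whole domain.\<close>
  have int_M: "integrable \<mu> g" if "g \<in> ?M" "\<mu> \<in> ?D" for g \<mu>
    using integrable_fs_span[of g "stat_funs h K" \<mu>] int_h that fs.span_base[of g ?M] eq by blast
  have "fs.span (\<Phi> ` stat_funs h K) = fs.span (\<Phi> ` ?M)"
  proof
    show "fs.span (\<Phi> ` stat_funs h K) \<subseteq> fs.span (\<Phi> ` ?M)"
      unfolding \<Phi>_def using eq fs.span_base[of _ "stat_funs h K"] int_M
      by (intro fs.span_minimal fs.subspace_span image_subsetI integral_functional_fs_span) auto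
    show "fs.span (\<Phi> ` ?M) \<subseteq> fs.span (\<Phi> ` stat_funs h K)"
      unfolding \<Phi>_def using eq fs.span_base[of _ ?M] int_h
      by (intro fs.span_minimal fs.subspace_span image_subsetI integral_functional_fs_span) auto
  qed
  moreover have "\<Phi> ` stat_funs h K = {on_dom ?D (\<lambda>\<mu>. 1)} \<union> (\<lambda>k. on_dom ?D (\<lambda>\<mu>. \<integral>z. h k z \<partial>\<mu>)) ` {1..K}"
  proof -
    \<comment> \<open>Members of the domain have mass one, so integrating the constant 1 gives the
      constant functional there.\<close>
    have "\<Phi> (\<lambda>_. 1) = on_dom ?D (\<lambda>\<mu>. 1)"
      by (auto simp: \<Phi>_def on_dom_def fun_eq_iff stat_dom_def prob_space.prob_space)
    then show ?thesis by (simp add: image_image \<Phi>_def)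
  qed
  moreover have "\<Phi> ` ?M = (\<lambda>l. on_dom ?D (moment l)) ` {0..L}"
    by (simp add: image_image \<Phi>_def moment_def[abs_def] atLeast0AtMost)
  moreover have "\<forall>\<mu>\<in>?D. \<forall>l\<le>L. integrable \<mu> (\<lambda>z. z ^ l)"
    using int_M by blast
  ultimately show ?thesis
    unfolding fspan_def using L by (intro exI[of _ L] conjI) simp_all
qed

end
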